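(* Let $n\ge2$, let $\mathbf r=(r_1,\dots,r_n)\in\mathbb{Z}_{\ge1}^n$, $N=r_1+\cdots+r_n$, $\mathbf r!=r_1!\cdots r_n!$ and $d=d_{N,n}$. Then for every $(q;p_1,\dots,p_{n-1})\in I_n$, $$\frac{d\,q^{N-n+1}}{\mathbf r!}\,s_{\mathbf r}(q;p_1,\dots,p_{n-1})\in\mathbb{Z}$$ and $$\frac{d\,q^{N-n+1}}{\mathbf r!}\,s_{\mathbf r}(q;p_1,\dots,p_{n-1})\;\equiv\;\sum_{\mathbf m}(-d)\prod_{i=1}^n\frac{B_{m_i}}{m_i!}\binom{m_i-1}{r_i-1}p_i^{m_i-r_i}\pmod q,$$ where $p_n:=-1$ and the sum is over all $n$-tuples $\mathbf m=(m_1,\dots,m_n)$ of non-negative even integers with $m_1+\cdots+m_n=N$ such that at least one $m_i$ is zero.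
   Context: $I_n$ is the set of $(q;p_1,\dots,p_{n-1})\in\mathbb{Z}_{>0}^n$ such that $p_1,\dots,p_{n-1}<q$ and each $p_i$ is relatively prime to $q$. Bernoulli polynomials $B_k(x)$ are defined by $\frac{ze^{xz}}{e^z-1}=\sum_{k\ge0}\frac{B_k(x)}{k!}z^k$, and $B_k=B_k(0)$ (so $B_1=-1/2$). The periodic Bernoulli function $\tilde B_k:\mathbb{R}\to\mathbb{R}$ has period $1$, with $\tilde B_k(t)=B_k(t)$ for $t\in(0,1)$, $\tilde B_k(0)=B_k$ for $k\neq1$, and $\tilde B_1(0)=0$. The generalized Dedekind sum is $$s_{\mathbf r}(q;p_1,\dots,p_{n-1})=\sum_{k_1,\dots,k_{n-1}\in\mathbb{Z}/q\mathbb{Z}}\tilde B_{r_1}\!\left(\tfrac{k_1}{q}\right)\cdots\tilde B_{r_{n-1}}\!\left(\tfrac{k_{n-1}}{q}\right)\tilde B_{r_n}\!\left(\tfrac{\sum_{i=1}^{n-1}p_ik_i}{q}\right).$$ $d_{N,n}$ is the least common multiple of the denominators of the coefficients of the $N$-th Todd polynomial in $n$ variables $$\mathrm{Todd}^N(x_1,\dots,x_n)=(-1)^N\sum_{m_1+\cdots+m_n=N,\ m_i\ge0}\ \prod_{i=1}^n\frac{B_{m_i}}{m_i!}x_i^{m_i}.$$ In particular each $d\prod_i B_{m_i}/m_i!$ with $\sum m_i=N$ is an integer. Binomial coefficients are $\binom{a}{k}=a(a-1)\cdots(a-k+1)/k!$ for $a\in\mathbb{Z}$, $k\ge0$; in particular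 $\binom{-1}{k}=(-1)^k$. Negative powers of $p_i$ modulo $q$ are powers of the inverse of $p_i$ modulo $q$. *)

theory Defs
  imports
    Complex_Main
    "HOL-Library.FuncSet"
    "HOL-Library.Poly_Mapping"
    "HOL-Computational_Algebra.Formal_Power_Series"
    "HOL-Number_Theory.Number_Theory"
begin

definition bernpoly :: "nat \<Rightarrow> 'a \<Rightarrow> 'a :: field_char_0" where
  "bernpoly k x = fact k * fps_nth (fps_X * fps_exp x / (fps_exp 1 - 1)) k"

definition bernoulli :: "nat \<Rightarrow> 'a :: field_char_0" where
  "bernoulli k = bernpoly k 0"

lemma bernpoly_egf:
  "Abs_fps (\<lambda>k. bernpoly k x / fact k) * (fps_exp 1 - 1) = fps_X * fps_exp (x :: 'a :: field_char_0)"
proof -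
  have sub: "subdegree (fps_exp 1 - 1 :: 'a fps) = 1" by (rule subdegreeI) auto
  then have nz: "fps_exp 1 - 1 \<noteq> (0 :: 'a fps)" by auto
  have "fps_nth (fps_X * fps_exp x) 1 \<noteq> 0" "fps_nth (fps_X * fps_exp x) 0 = 0" by simp_all
  then have "subdegree (fps_X * fps_exp x) = 1" and "fps_X * fps_exp x \<noteq> 0"
    by (auto intro!: subdegreeI)
  with sub nz have "(fps_exp 1 - 1) dvd (fps_X * fps_exp x)" by (simp add: fps_dvd_iff)
  then show ?thesis by (simp add: bernpoly_def fps_nth_inverse)
qed

lemma bernoulli_0_1: "bernoulli 0 = (1 :: 'a :: field_char_0)" "bernoulli 1 = (- 1 / 2 :: 'a)"
proof -
  have *: "fps_nth (Abs_fps (\<lambda>k. bernpoly k 0 / fact k) * (fps_exp 1 - 1)) k =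
      fps_nth (fps_X :: 'a fps) k" for k by (simp add: bernpoly_egf)
  from *[of 1] show 0: "bernoulli 0 = (1 :: 'a)" by (simp add: fps_mult_nth bernoulli_def)
  with *[of 2] have "2 * (1 + 2 * bernoulli 1) = (0 :: 'a)"
    by (simp add: fps_mult_nth bernoulli_def numeral_2_eq_2 field_simps)
  then show "bernoulli 1 = (- 1 / 2 :: 'a)"
    by (simp only: mult_eq_0_iff) (simp add: add_eq_0_iff field_simps)
qed

definition pbernpoly :: "nat \<Rightarrow> real \<Rightarrow> real" where
  "pbernpoly k t =
     (if t \<in> \<int> then (if k = 1 then 0 else bernoulli k) else bernpoly k (frac t))"

text \<open>
  Tuples indexed by \<open>1, \<dots>, n\<close> are functions on \<open>nat\<close>, of which only the values at
  \<open>1, \<dots>, n\<close> matter; they are taken extensional where they are counted or summed over.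
\<close>

definition I_set :: "nat \<Rightarrow> (int \<times> (nat \<Rightarrow> int)) set" where
  "I_set n = {(q, p). q > 0 \<and> (\<forall>i\<in>{1..<n}. 0 < p i \<and> p i < q \<and> coprime (p i) q)}"

text \<open>
  The sum over \<open>(\<int>/q\<int>)\<^bsup>n-1\<^esup>\<close> is taken over the representatives
  \<open>0, \<dots>, q - 1\<close>; the summand has period \<open>q\<close> in each \<open>k i\<close>.
\<close>
definition dedekind_sum :: "nat \<Rightarrow> (nat \<Rightarrow> nat) \<Rightarrow> int \<Rightarrow> (nat \<Rightarrow> int) \<Rightarrow> real" where
  "dedekind_sum n r q p =
     (\<Sum>k\<in>{1..<n} \<rightarrow>\<^sub>E {0..<q}.
        (\<Prod>i\<in>{1..<n}. pbernpoly (r i) (of_int (k i) / of_int q)) *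
        pbernpoly (r n) (of_int (\<Sum>i\<in>{1..<n}. p i * k i) / of_int q))"

text \<open>The bound \<open>m i \<le> N\<close> is implied by the sum condition; it makes finiteness evident.\<close>
definition weak_compositions :: "nat \<Rightarrow> nat \<Rightarrow> (nat \<Rightarrow> nat) set" where
  "weak_compositions N n = {m \<in> {1..n} \<rightarrow>\<^sub>E {..N}. (\<Sum>i\<in>{1..n}. m i) = N}"

text \<open>
  Multivariate polynomials are finitely supported maps from exponent vectors to coefficients:
  \<open>single (single i k) c\<close> is the monomial \<open>c x\<^sub>i\<^sup>k\<close>.
\<close>
definition todd_poly :: "nat \<Rightarrow> nat \<Rightarrow> (nat \<Rightarrow>\<^sub>0 nat) \<Rightarrow>\<^sub>0 rat" where
  "todd_poly N n = (-1) ^ N *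
     (\<Sum>m\<in>weak_compositions N n.
        \<Prod>i\<in>{1..n}. Poly_Mapping.single (Poly_Mapping.single i (m i)) (bernoulli (m i) / fact (m i)))"

definition todd_denom :: "nat \<Rightarrow> nat \<Rightarrow> int" where
  "todd_denom N n =
     Lcm ((\<lambda>a. snd (quotient_of (Poly_Mapping.lookup (todd_poly N n) a))) `
            Poly_Mapping.keys (todd_poly N n))"

lemma todd_poly_lookup:
  assumes "m \<in> weak_compositions N n"
  shows "Poly_Mapping.lookup (todd_poly N n) (\<Sum>i\<in>{1..n}. Poly_Mapping.single i (m i)) =
    (-1) ^ N * (\<Prod>i\<in>{1..n}. bernoulli (m i) / fact (m i))"
proof -
  let ?e = "\<lambda>m. \<Sum>i\<in>{1..n}. Poly_Mapping.single i (m i :: nat)"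
  have fin: "finite (weak_compositions N n)"
    unfolding weak_compositions_def by (intro finite_Collect_conjI disjI1) (simp_all add: finite_PiE)
  have lk: "Poly_Mapping.lookup (?e m) j = (if j \<in> {1..n} then m j else 0)" for m j
    by (simp add: lookup_sum lookup_single when_def)
  have inj: "m' = m" if "m' \<in> weak_compositions N n" "?e m' = ?e m" for m'
  proof (rule PiE_ext)
    show "m' \<in> {1..n} \<rightarrow>\<^sub>E {..N}" "m \<in> {1..n} \<rightarrow>\<^sub>E {..N}"
      using that assms by (auto simp: weak_compositions_def)
    fix i assume "i \<in> {1..n}" then show "m' i = m i" using lk[of m i] lk[of m' i] that by simp
  qed
  have pr: "(\<Prod>i\<in>A. Poly_Mapping.single (f i) (g i)) =
     Poly_Mapping.single (\<Sum>i\<in>A. f i) (\<Prod>i\<in>A. g i)" if "finite A"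
     for A and f :: "nat \<Rightarrow> nat \<Rightarrow>\<^sub>0 nat" and g :: "nat \<Rightarrow> rat"
    using that by induction (auto simp: mult_single)
  have "(-1) ^ N = (Poly_Mapping.single 0 ((-1) ^ N) :: (nat \<Rightarrow>\<^sub>0 nat) \<Rightarrow>\<^sub>0 rat)"
    by (cases "even N") (simp_all add: single_uminus)
  then have "todd_poly N n = (\<Sum>m\<in>weak_compositions N n. Poly_Mapping.single (?e m)
      ((-1) ^ N * (\<Prod>i\<in>{1..n}. bernoulli (m i) / fact (m i))))"
    by (simp add: todd_poly_def pr sum_distrib_left mult_single)
  then have "Poly_Mapping.lookup (todd_poly N n) (?e m) = (\<Sum>m'\<in>weak_compositions N n.
      if m' = m then (-1) ^ N * (\<Prod>i\<in>{1..n}. bernoulli (m i) / fact (m i)) else 0)"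
    by (simp only: lookup_sum lookup_single when_def) (rule sum.cong[OF refl], use inj in metis)
  then show ?thesis using fin assms by simp
qed

lemma todd_denom_integral:
  assumes "m \<in> weak_compositions N n"
  shows "of_int (todd_denom N n) * (\<Prod>i\<in>{1..n}. bernoulli (m i) / fact (m i)) \<in> (\<int> :: rat set)"
proof -
  define c where "c = Poly_Mapping.lookup (todd_poly N n) (\<Sum>i\<in>{1..n}. Poly_Mapping.single i (m i))"
  have "of_int (todd_denom N n) * c \<in> \<int>"
  proof (cases "c = 0")
    case False
    then have "(\<Sum>i\<in>{1..n}. Poly_Mapping.single i (m i)) \<in> Poly_Mapping.keys (todd_poly N n)"
      by (simp add: c_def in_keys_iff)
    then have "snd (quotient_of c) dvd todd_denom N n"
      unfolding todd_denom_def c_def by (intro dvd_Lcm) auto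
    moreover obtain a b where ab: "quotient_of c = (a, b)" by (cases "quotient_of c")
    ultimately obtain k where "todd_denom N n = b * k" by (auto elim: dvdE)
    moreover have "b > 0" "c = of_int a / of_int b"
      using ab by (simp_all add: quotient_of_denom_pos quotient_of_div)
    ultimately have "of_int (todd_denom N n) * c = of_int (k * a)" by simp
    then show ?thesis by (simp only: Ints_of_int)
  qed simp
  then show ?thesis unfolding c_def todd_poly_lookup[OF assms]
    by (cases "even N") simp_all
qed

text \<open>A representative of \<open>a\<^sup>e\<close> modulo \<open>q\<close>, for \<open>a\<close> coprime to \<open>q\<close>.\<close>
definition mod_powi :: "int \<Rightarrow> int \<Rightarrow> int \<Rightarrow> int" where
  "mod_powi q a e = (if e \<ge> 0 then a ^ nat e else modular_inverse q a ^ nat (- e))"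

definition even_compositions_with_zero :: "nat \<Rightarrow> nat \<Rightarrow> (nat \<Rightarrow> nat) set" where
  "even_compositions_with_zero N n =
     {m \<in> weak_compositions N n. (\<forall>i\<in>{1..n}. even (m i)) \<and> (\<exists>i\<in>{1..n}. m i = 0)}"

end

theory Submission
  imports Defs
    "HOL-Computational_Algebra.Formal_Laurent_Series"
    "HOL-Library.Multiset"
begin

text \<open>
  By finite Fourier analysis, \<open>q\<^bsup>N-n+1\<^esup> s\<^sub>r / r!\<close> is the sum \<open>S\<close> of
  \<open>\<Prod>\<^sub>i \<beta>\<^sub>r\<^sub>i(z\<^bsup>p i\<^esup>)\<close> over the \<open>q\<close>-th roots of unity \<open>z\<close>, where \<open>\<beta>\<^sub>r(u)\<close> is the
  coefficient of \<open>t\<^bsup>r-1\<^esup>\<close> in \<open>1 / (u e\<^bsup>t\<^esup> - 1) + 1 / 2\<close>.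
  Consider, as a function of \<open>v = e\<^bsup>t\<^esup>\<close>, the product of \<open>1 / (v\<^bsup>q\<^esup> - 1) + 1 / 2\<close> and of the
  \<open>(r\<^sub>i - 1)\<close>-st derivatives of \<open>1 / (v\<^bsup>p i\<^esup> - 1) + 1 / 2\<close> with respect to \<open>t\<close>. Its poles are roots of unity.
  The residue theorem expresses \<open>S\<close>, up to an explicit constant, through sums of the same kind
  and of the same weight \<open>N\<close>, with at most \<open>n\<close> factors, over roots of unity of order
  \<open>gcd(p\<^sub>j : m\<^sub>j = 0)\<close> (\<open>p\<^sub>0 = q\<close>).

  Fix a prime \<open>l\<close>. If \<open>l\<close> does not divide \<open>q\<close>, each \<open>p\<^sub>i\<close> that \<open>q\<close> does not divide may be replaced by a residue
  of \<open>\<plusminus>p\<^sub>i\<close> below \<open>q\<close> that is prime to \<open>l\<close>, and strong induction on \<open>q\<close> shows that \<open>d S\<close> is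
  \<open>l\<close>-integral. If \<open>l\<close> divides \<open>q\<close>, all orders that occur on the right are prime to \<open>l\<close>, and the
  terms without a factor \<open>q\<close> are exactly those over the trivial root of unity, which make up the sum over
  even tuples.
\<close>

subsection \<open>Roots of unity and the functions 1 / (u exp t - 1) + 1 / 2\<close>

abbreviation runity :: "nat \<Rightarrow> complex set" where
  "runity q \<equiv> {z. z ^ q = 1}"

lemma finite_runity: "q > 0 \<Longrightarrow> finite (runity q)"
  by (intro finite_roots_unity) simp

lemma runity_nonzero: "z \<in> runity q \<Longrightarrow> q > 0 \<Longrightarrow> z \<noteq> 0"
  by (auto simp: power_0_left)

lemma sum_power_runity:
  assumes q: "q > 0"
  shows "(\<Sum>z\<in>runity q. z ^ j) = (if q dvd j then of_nat q else 0)"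
proof -
  define w where "w = cis (2 * pi / real q)"
  have wq: "w ^ q = 1" using q by (simp add: w_def DeMoivre)
  have "(\<Sum>z\<in>runity q. z ^ j) = (\<Sum>k<q. (cis (2 * pi * real k / real q)) ^ j)"
    using q by (intro sum.reindex_bij_betw [symmetric] bij_betw_roots_unity)
  also have "\<dots> = (\<Sum>k<q. (w ^ j) ^ k)"
    by (intro sum.cong) (simp_all add: w_def DeMoivre mult_ac)
  finally have eq: "(\<Sum>z\<in>runity q. z ^ j) = (\<Sum>k<q. (w ^ j) ^ k)" .
  show ?thesis
  proof (cases "q dvd j")
    case True
    then have "w ^ j = 1" using wq by (auto elim!: dvdE simp: power_mult)
    then show ?thesis using True eq by simp
  next
    case False
    have "w ^ j \<noteq> 1"
    proof
      assume "w ^ j = 1"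
      then have "cis (2 * pi * real j / real q) = 1"
        by (simp add: w_def DeMoivre mult_ac)
      then obtain x :: int where "2 * pi * real j / real q = of_int x * 2 * pi"
        by (auto simp: complex_eq_iff cos_one_2pi_int)
      then have "real j = of_int x * real q" using q by (simp add: field_simps)
      then have "real_of_int (int j) = real_of_int (x * int q)" by simp
      then have "int j = x * int q" by (simp only: of_int_eq_iff)
      then have "int q dvd int j" by simp
      with False show False by simp
    qed
    then show ?thesis using False eq geometric_sum[of "w ^ j" q] wq
      by (simp flip: power_mult add: mult.commute[of j q]) (simp add: power_mult)
  qed
qed

text \<open>Orthogonality of characters without negative powers: \<open>z ^ (q - k)\<close> replaces
  \<open>inverse z ^ k\<close>, and since 0 < q - k + l < 2 q, the only multiple of \<open>q\<close>
  available is \<open>q\<close> itself.\<close>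

lemma sum_runity_character:
  assumes q: "q > 0" and kl: "k < q" "l < q"
  shows "(\<Sum>z\<in>runity q. inverse z ^ k * z ^ l) = (if k = l then of_nat q else 0)"
proof -
  have "inverse z ^ k * z ^ l = z ^ (q - k + l)" if "z \<in> runity q" for z
  proof -
    have "z ^ k * z ^ (q - k) = 1" using that kl by (simp flip: power_add)
    then have "inverse z ^ k = z ^ (q - k)"
      by (metis inverse_unique power_inverse)
    then show ?thesis by (simp add: power_add)
  qed
  then have "(\<Sum>z\<in>runity q. inverse z ^ k * z ^ l) = (\<Sum>z\<in>runity q. z ^ (q - k + l))"
    by (intro sum.cong) auto
  moreover have "q dvd q - k + l \<longleftrightarrow> k = l"
  proof
    assume "q dvd q - k + l"
    then obtain c where c: "q - k + l = q * c" by (elim dvdE)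
    have "0 < q - k + l" "q - k + l < q * 2" using kl by linarith+
    then have "c > 0" "c < 2" unfolding c using q by auto
    then have "c = 1" by simp
    with c kl show "k = l" by simp
  qed (use kl in simp)
  ultimately show ?thesis by (simp add: sum_power_runity[OF q])
qed

lemma fls_const_sum: "fls_const (sum f A) = (\<Sum>x\<in>A. fls_const (f x))"
  by (induction A rule: infinite_finite_induct) (simp_all flip: fls_plus_const)

text \<open>Partial fractions: as (z x)^q = x^q, 1 / (z x - 1) is the geometric sum of the (z x)^l
  with l < q, divided by x^q - 1; orthogonality then selects l = k. The case k = 0 yields the
  distribution relation, general k the Fourier transform of \<open>bern\<close>.\<close>

lemma sum_runity_inverse:
  fixes x :: "complex fls"
  assumes q: "q > 0" and k: "k < q" and x: "x ^ q \<noteq> 1"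
  shows "(\<Sum>z\<in>runity q. fls_const (inverse z ^ k) * inverse (fls_const z * x - 1)) =
    of_nat q * x ^ k * inverse (x ^ q - 1)"
proof -
  have inv: "inverse (fls_const z * x - 1) = (\<Sum>l<q. (fls_const z * x) ^ l) * inverse (x ^ q - 1)"
    if "z \<in> runity q" for z
  proof -
    have "(fls_const z * x) ^ q = x ^ q" using that
      by (simp add: power_mult_distrib flip: fls_const_power)
    then have "(fls_const z * x - 1) * (\<Sum>l<q. (fls_const z * x) ^ l) = x ^ q - 1"
      by (simp flip: power_diff_1_eq)
    then show ?thesis using x by (intro inverse_unique) (simp flip: mult.assoc)
  qed
  have "(\<Sum>z\<in>runity q. fls_const (inverse z ^ k) * inverse (fls_const z * x - 1)) =
     (\<Sum>z\<in>runity q. \<Sum>l<q. fls_const (inverse z ^ k * z ^ l) * x ^ l * inverse (x ^ q - 1))"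
    by (intro sum.cong refl)
      (simp add: inv sum_distrib_left sum_distrib_right power_mult_distrib fls_const_power
        fls_const_mult_const mult.assoc flip: fls_const_mult_const)
  also have "\<dots> = (\<Sum>l<q. fls_const (\<Sum>z\<in>runity q. inverse z ^ k * z ^ l) * x ^ l * inverse (x ^ q - 1))"
    by (subst sum.swap) (simp add: fls_const_sum sum_distrib_right)
  also have "\<dots> = (\<Sum>l<q. if l = k then of_nat q * x ^ k * inverse (x ^ q - 1) else 0)"
    by (intro sum.cong refl) (use q k in \<open>auto simp: sum_runity_character fls_of_nat\<close>)
  finally show ?thesis using k by simp
qed

text \<open>This is \<open>coth ((c t + ln u) / 2) / 2\<close> as a Laurent series in \<open>t\<close>.\<close>
definition cth :: "complex \<Rightarrow> complex \<Rightarrow> complex fls" where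
  "cth c u = inverse (fps_to_fls (fps_const u * fps_exp c - 1)) + fls_const (1 / 2)"

text \<open>The coefficient written beta in the overview. The offset makes \<open>bern m 1\<close>
  equal to B_m / m! for m \<noteq> 1 and to 0 for m = 1, and makes \<open>bern 0\<close> the residue
  at t = 0.\<close>

definition bern :: "nat \<Rightarrow> complex \<Rightarrow> complex" where
  "bern m u = fls_nth (cth 1 u) (int m - 1)"

lemma cth_denominator_nonzero:
  assumes "c \<noteq> 0" "u \<noteq> 0"
  shows "fps_const u * fps_exp c - 1 \<noteq> (0 :: complex fps)"
proof
  assume "fps_const u * fps_exp c - 1 = 0"
  then have "fps_nth (fps_const u * fps_exp c - 1) 1 = 0" by simp
  with assms show False by simp
qed

text \<open>\<open>cth c u\<close> arises from \<open>cth 1 u\<close> by substituting c t for t.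
  This is the source of the powers of p_i in the theorem.\<close>

lemma cth_nth:
  assumes "c \<noteq> 0" "u \<noteq> 0"
  shows "fls_nth (cth c u) k = c powi k * fls_nth (cth 1 u) k"
proof -
  define L where "L = fps_const c * (fps_X :: complex fps)"
  have L: "fps_nth L 0 = 0" "L \<noteq> 0" using assms by (simp_all add: L_def)
  have "fps_const u * fps_exp c - 1 = fps_compose (fps_const u * fps_exp 1 - 1) L"
    by (simp add: fps_compose_sub_distrib fps_compose_mult_distrib L_def)
  then have "cth c u = fls_compose_fps (cth 1 u) L"
    by (simp only: cth_def fls_compose_fps_add[OF L(2,1)] fls_compose_fps_inverse[OF L(2,1)]
      fls_compose_fps_to_fls[OF L(2,1)] fls_compose_fps_const)
  then show ?thesis using fls_nth_fls_compose_fps_linear[OF assms(1), of "cth 1 u" k]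
    by (simp only: L_def mult.commute)
qed

text \<open>coth is odd, and passing to (-t, 1 / u) negates its argument t + ln u. Rationally: 1 /
  (1 / x - 1) + 1 / 2 = -(1 / (x - 1) + 1 / 2).\<close>

lemma cth_minus:
  assumes "u \<noteq> 0"
  shows "cth (-1) (inverse u) = - cth 1 u"
proof -
  let ?E = "fps_to_fls (fps_exp 1 :: complex fps)"
  have E1: "fps_to_fls (fps_exp (-1) :: complex fps) * ?E = 1"
    by (simp flip: fls_times_fps_to_fls fps_exp_add_mult)
  then have E: "fps_to_fls (fps_exp (-1) :: complex fps) = inverse ?E"
    by (metis inverse_unique mult.commute)
  have E0: "?E \<noteq> 0" using E1 by auto
  define x where "x = fls_const u * ?E"
  have x0: "x \<noteq> 0" using E0 assms by (simp add: x_def)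
  have "x - 1 = fps_to_fls (fps_const u * fps_exp 1 - 1)"
    by (simp add: x_def fls_times_fps_to_fls)
  moreover from this have x1: "x - 1 \<noteq> 0" using cth_denominator_nonzero[of 1 u] assms
    by (metis fps_to_fls_eq_0_iff zero_neq_one)
  moreover have "inverse x - 1 = fps_to_fls (fps_const (inverse u) * fps_exp (-1) - 1)"
    by (simp add: x_def fls_times_fps_to_fls E fls_inverse_const)
  ultimately have eq: "cth 1 u = inverse (x - 1) + fls_const (1/2)"
     "cth (-1) (inverse u) = inverse (inverse x - 1) + fls_const (1/2)"
    by (simp_all add: cth_def)
  have half: "fls_const (1/2) = (1/2 :: complex fls)"
    by (metis fls_const_divide_const fls_const_1 fls_const_numeral)
  show ?thesis unfolding eq half using x0 x1
    by (simp add: field_simps)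
qed

lemma bern_inverse:
  assumes "u \<noteq> 0" "m \<noteq> 0"
  shows "bern m (inverse u) = (-1) ^ m * bern m u"
proof -
  obtain k where k: "m = Suc k" using assms(2) not0_implies_Suc by blast
  have "- fls_nth (cth 1 u) k = (-1) ^ k * fls_nth (cth 1 (inverse u)) k"
    using cth_nth[of "-1" "inverse u" "int k"] assms by (simp add: cth_minus)
  then have "(-1) ^ k * (- fls_nth (cth 1 u) k) = ((-1) ^ k * (-1) ^ k) * fls_nth (cth 1 (inverse u)) k"
    by simp
  then show ?thesis by (simp add: bern_def k flip: power_mult_distrib)
qed

text \<open>The poles in \<open>v\<close> are distributed over \<open>p\<close> factors with a
  single pole each. This places the left side in the algebra generated by the
  \<open>cth 1 (z * v)\<close>, where residues can be summed.\<close>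

lemma cth_distribution:
  assumes "p > 0" "v \<noteq> 0"
  shows "cth (of_nat p) (v ^ p) = fls_const (1 / of_nat p) * (\<Sum>z\<in>runity p. cth 1 (z * v))"
proof -
  define x where "x = fps_to_fls (fps_const v * fps_exp 1)"
  have xp: "x ^ p - 1 = fps_to_fls (fps_const (v ^ p) * fps_exp (of_nat p) - 1)"
    by (simp add: x_def power_mult_distrib fps_const_power fps_exp_power_mult flip: fps_to_fls_power)
  have "x ^ p \<noteq> 1"
    using cth_denominator_nonzero[of "of_nat p" "v ^ p"] assms xp
    by (metis diff_self fps_to_fls_eq_0_iff of_nat_eq_0_iff less_irrefl power_not_zero)
  from sum_runity_inverse[OF assms(1) assms(1) this]
  have "(\<Sum>z\<in>runity p. inverse (fls_const z * x - 1)) = of_nat p * inverse (x ^ p - 1)" by simp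
  moreover have "cth 1 (z * v) = inverse (fls_const z * x - 1) + fls_const (1/2)" for z
    by (simp add: cth_def x_def fls_times_fps_to_fls flip: fls_const_mult_const mult.assoc)
  ultimately have "(\<Sum>z\<in>runity p. cth 1 (z * v)) =
    of_nat p * inverse (x ^ p - 1) + of_nat (card (runity p)) * fls_const (1/2)"
    by (simp add: sum.distrib)
  also have "card (runity p) = p" using assms(1) by (rule card_roots_unity_eq)
  finally have "(\<Sum>z\<in>runity p. cth 1 (z * v)) = of_nat p * cth (of_nat p) (v ^ p)"
    by (simp only: cth_def xp distrib_left)
  moreover have "fls_const (1 / of_nat p) * of_nat p = (1 :: complex fls)"
    using assms(1) by (simp add: fls_of_nat)
  ultimately show ?thesis by (simp flip: mult.assoc)
qed

subsection \<open>The residue theorem\<close>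

text \<open>At u = 1 the expansion is the Bernoulli generating function divided by t, with 1 / 2
  cancelling B_1. For u \<noteq> 1 the denominator is a unit among power series, so there is no
  polar part; hence \<open>bern 0\<close> detects u = 1.\<close>

lemma bern_at_1: "bern m 1 = bernoulli m / fact m + (if m = 1 then 1 / 2 else 0)"
  and cth_nth_less: "u \<noteq> 0 \<Longrightarrow> k < -1 \<Longrightarrow> fls_nth (cth 1 u) k = 0"
  and bern_0: "u \<noteq> 0 \<Longrightarrow> bern 0 u = (if u = 1 then 1 else 0)"
proof -
  define B where "B = Abs_fps (\<lambda>k. bernpoly k 0 / fact k :: complex)"
  have "B * (fps_exp 1 - 1) = fps_X" unfolding B_def by (simp add: bernpoly_egf)
  then have "fps_to_fls (fps_exp 1 - 1) * (fls_X_inv * fps_to_fls B) = (1 :: complex fls)"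
    by (metis fls_times_fps_to_fls fls_inverse_X fls_X_nonzero left_inverse fps_X_to_fls
        mult.assoc mult.commute)
  then have "inverse (fps_to_fls (fps_exp 1 - 1)) = fls_X_inv * fps_to_fls B"
    by (rule inverse_unique)
  then have c1: "fls_nth (cth 1 1) k = fls_nth (fps_to_fls B) (k + 1) + (if k = 0 then 1 / 2 else 0)" for k
    by (simp add: cth_def fls_X_inv_times_conv_shift)
  then have b1: "bern m 1 = bernoulli m / fact m + (if m = 1 then 1 / 2 else 0)" for m
    by (simp add: bern_def B_def bernoulli_def)
  then show "bern m 1 = bernoulli m / fact m + (if m = 1 then 1 / 2 else 0)" .
  have "\<exists>F. cth 1 u = fps_to_fls F" if "u \<noteq> 1"
  proof -
    have "inverse (fps_to_fls (fps_const u * fps_exp 1 - 1)) =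
        fps_to_fls (inverse (fps_const u * fps_exp 1 - 1))"
      by (rule fls_inverse_fps_to_fls) (use that in \<open>simp add: subdegree_eq_0_iff\<close>)
    then have "cth 1 u = fps_to_fls (inverse (fps_const u * fps_exp 1 - 1) + fps_const (1 / 2))"
      by (simp only: cth_def fps_to_fls_plus fps_const_to_fls)
    then show ?thesis by blast
  qed
  then have c2: "fls_nth (cth 1 u) k = 0" if "u \<noteq> 1" "k < 0" for k
    using that by auto
  show "u \<noteq> 0 \<Longrightarrow> k < -1 \<Longrightarrow> fls_nth (cth 1 u) k = 0"
    using c1[of k] c2[of k] by (cases "u = 1") auto
  show "u \<noteq> 0 \<Longrightarrow> bern 0 u = (if u = 1 then 1 else 0)"
    using c2[of "-1"] b1[of 0] by (auto simp: bern_def bernoulli_0_1)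
qed

lemma fls_const_half: "fls_const (1 / 2) = (1 / 2 :: complex fls)"
  by (metis fls_const_divide_const fls_const_1 fls_const_numeral)

text \<open>The Riccati equation of coth. It holds because y = u exp t - 1 satisfies y' = y +
  1.\<close>

lemma fls_deriv_cth:
  assumes "u \<noteq> 0"
  shows "fls_deriv (cth 1 u) = fls_const (1 / 4) - cth 1 u * cth 1 u"
proof -
  define y where "y = fps_to_fls (fps_const u * fps_exp 1 - 1)"
  have y0: "y \<noteq> 0" using cth_denominator_nonzero[of 1 u] assms
    by (metis fps_to_fls_eq_0_iff zero_neq_one y_def)
  have y': "fls_deriv y = y + 1"
    by (simp add: y_def fls_deriv_fps_to_fls fls_times_fps_to_fls)
  have quarter: "fls_const (1 / 4) = (1 / 4 :: complex fls)"
    by (metis fls_const_divide_const fls_const_1 fls_const_numeral)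
  have "fls_deriv (cth 1 u) = - inverse y * (y + 1) * inverse y"
    unfolding cth_def y_def[symmetric] by (simp add: fls_inverse_deriv_divring y')
  also have "\<dots> = 1 / 4 - (inverse y + 1 / 2) * (inverse y + 1 / 2)"
    using y0 by (simp add: field_simps power2_eq_square)
  finally show ?thesis unfolding cth_def y_def[symmetric] fls_const_half quarter .
qed

text \<open>Partial fractions for two factors with different poles, that is, the addition theorem of
  coth. It lowers the number of factors in a product.\<close>

lemma cth_mult_cth:
  assumes "u \<noteq> 0" "w \<noteq> 0" "u \<noteq> w" "v \<noteq> 0"
  shows "cth 1 (u * v) * cth 1 (w * v) =
    fls_const ((u + w) / (2 * (w - u))) * (cth 1 (u * v) - cth 1 (w * v)) + fls_const (1 / 4)"
proof -
  define y where "y u = fps_to_fls (fps_const (u * v) * fps_exp 1 - 1)" for u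
  have y0: "y u \<noteq> 0" if "u \<noteq> 0" for u using cth_denominator_nonzero[of 1 "u * v"] assms that
    by (metis fps_to_fls_eq_0_iff zero_neq_one y_def mult_eq_0_iff)
  define U W where "U = fls_const u" and "W = fls_const w"
  have UW: "W - U \<noteq> 0" using assms 
    by (auto simp: U_def W_def dest: arg_cong[of _ _ "\<lambda>F. fls_nth F 0"])
  have y: "y u = fls_const u * fps_to_fls (fps_const v * fps_exp 1) - 1" for u
    by (simp add: y_def fls_times_fps_to_fls flip: fls_const_mult_const mult.assoc)
  have rel: "U * y w - W * y u = W - U"
    by (simp add: y U_def W_def algebra_simps)
  have quarter: "fls_const (1 / 4) = (1 / 4 :: complex fls)"
    by (metis fls_const_divide_const fls_const_1 fls_const_numeral)
  have coef: "fls_const ((u + w) / (2 * (w - u))) = (U + W) / (2 * (W - U))"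
    by (simp only: U_def W_def fls_plus_const fls_minus_const fls_const_mult_const
      fls_const_divide_const flip: fls_const_numeral)
  have *: "inverse (y u) * inverse (y w) * (W - U) = U * inverse (y u) - W * inverse (y w)"
    unfolding rel[symmetric] using y0 assms by (simp add: field_simps)
  then have *: "inverse (y u) * inverse (y w) = (U * inverse (y u) - W * inverse (y w)) / (W - U)"
    using UW by (simp add: field_simps)
  have "(inverse (y u) + 1 / 2) * (inverse (y w) + 1 / 2) =
    inverse (y u) * inverse (y w) + (inverse (y u) + inverse (y w)) / 2 + 1 / 4"
    by (simp add: algebra_simps add_divide_distrib)
  also have "\<dots> = (U + W) / (2 * (W - U)) * ((inverse (y u) + 1 / 2) - (inverse (y w) + 1 / 2)) + 1 / 4"
  proof -
    have "(U * a - W * b) / (W - U) + (a + b) / 2 = (U + W) / (2 * (W - U)) * (a - b)" for a b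
      using UW by (simp add: divide_simps) (simp add: algebra_simps)
    then show ?thesis unfolding * by simp
  qed
  finally show ?thesis
    unfolding cth_def y_def[symmetric] fls_const_half quarter coef .
qed

text \<open>The residue theorem for the differential dx / x with x = v exp t: the right side is the
  value of the product at infinity minus its value at 0. The proof is algebraic: two factors with
  different poles are merged by partial fractions, two equal ones by the Riccati equation. A
  multiset is used since poles may repeat.\<close>

lemma sum_residue_prod_cth:
  assumes V: "finite V" "0 \<notin> V"
    and M: "\<forall>u\<in>#M. u \<noteq> 0 \<and> inverse u \<in> V"
  shows "(\<Sum>v\<in>V. fls_nth (\<Prod>u\<in>#M. cth 1 (u * v)) (-1)) = (1 / 2) ^ size M - (-1 / 2) ^ size M"
  using M
proof (induction "size M" arbitrary: M rule: less_induct)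
  case less
  consider "M = {#}" | u where "M = {#u#}" 
    | u w M' where "M = add_mset u (add_mset w M')" "u \<noteq> w"
    | u k where "M = replicate_mset (Suc (Suc k)) u"
  proof (cases "\<exists>u w. u \<in># M \<and> w \<in># M \<and> u \<noteq> w")
    case True
    then obtain u w where uw: "u \<in># M" "w \<in># M" "u \<noteq> w" by blast
    then obtain M1 where M1: "M = add_mset u M1" by (meson mset_add)
    with uw obtain M' where "M1 = add_mset w M'" by (metis insert_noteq_member mset_add)
    then show ?thesis using that(3) M1 uw by blast
  next
    case False
    show ?thesis
    proof (cases "M = {#}")
      case False
      then obtain u where "u \<in># M" by blast
      with \<open>\<not> (\<exists>u w. _ u w)\<close> have "set_mset M = {u}" by blast
      then have M: "M = replicate_mset (size M) u" by (simp add: set_mset_subset_singletonD)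
      show ?thesis
      proof (cases "size M")
        case (Suc k)
        then have "M = replicate_mset (Suc k) u" using M by metis
        then show ?thesis using that(2,4) by (cases k) auto
      qed (use False in simp)
    qed (rule that)
  qed
  then show ?case
  proof cases
    case (2 u)
    then have u: "u \<noteq> 0" "inverse u \<in> V" using less.prems by auto
    have "(\<Sum>v\<in>V. fls_nth (cth 1 (u * v)) (-1)) = (\<Sum>v\<in>V. if v = inverse u then 1 else 0)"
    proof (intro sum.cong refl)
      fix v assume "v \<in> V"
      then have "v \<noteq> 0" using V by auto
      then have "u * v = 1 \<longleftrightarrow> v = inverse u" using u by (auto simp: field_simps)
      then show "fls_nth (cth 1 (u * v)) (-1) = (if v = inverse u then 1 else 0)"
        using bern_0[of "u * v"] u \<open>v \<noteq> 0\<close> by (simp add: bern_def)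
    qed
    then show ?thesis using 2 u V by simp
  next
    case (3 u w M')
    define a where "a = (u + w) / (2 * (w - u))"
    let ?S = "\<lambda>M. \<Sum>v\<in>V. fls_nth (\<Prod>u\<in>#M. cth 1 (u * v)) (-1)"
    have "fls_nth (\<Prod>u\<in>#M. cth 1 (u * v)) (-1) =
        a * (fls_nth (\<Prod>u\<in>#add_mset u M'. cth 1 (u * v)) (-1)
          - fls_nth (\<Prod>u\<in>#add_mset w M'. cth 1 (u * v)) (-1))
        + 1 / 4 * fls_nth (\<Prod>u\<in>#M'. cth 1 (u * v)) (-1)" if "v \<in> V" for v
    proof -
      have "v \<noteq> 0" "u \<noteq> 0" "w \<noteq> 0" using that V less.prems 3 by auto
      note rel = cth_mult_cth[OF this(2,3) 3(2) this(1), folded a_def]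
      have "(\<Prod>u\<in>#M. cth 1 (u * v)) = (cth 1 (u * v) * cth 1 (w * v)) * (\<Prod>u\<in>#M'. cth 1 (u * v))"
        using 3 by (simp add: mult.assoc)
      also have "\<dots> = fls_const a * ((\<Prod>u\<in>#add_mset u M'. cth 1 (u * v)) - (\<Prod>u\<in>#add_mset w M'. cth 1 (u * v)))
          + fls_const (1 / 4) * (\<Prod>u\<in>#M'. cth 1 (u * v))"
        unfolding rel by (simp add: algebra_simps)
      finally show ?thesis by simp
    qed
    then have "?S M = a * (?S (add_mset u M') - ?S (add_mset w M')) + 1 / 4 * ?S M'"
      by (simp add: sum.distrib sum_subtractf flip: sum_distrib_left sum_divide_distrib)
    \<comment> \<open>Both multisets have the same size, so their sums agree by induction and the
      term with \<open>a\<close> drops out.\<close>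
    also have "?S (add_mset u M') = (1 / 2) ^ Suc (size M') - (-1 / 2) ^ Suc (size M')"
      by (subst less.hyps) (use 3 less.prems in auto)
    also have "?S (add_mset w M') = (1 / 2) ^ Suc (size M') - (-1 / 2) ^ Suc (size M')"
      by (subst less.hyps) (use 3 less.prems in auto)
    also have "?S M' = (1 / 2) ^ size M' - (-1 / 2) ^ size M'"
      by (subst less.hyps) (use 3 less.prems in auto)
    finally show ?thesis using 3 by (simp add: field_simps)
  next
    case (4 u k)
    have st: "fls_nth (\<Prod>u\<in>#M. cth 1 (u * v)) (-1) =
        1 / 4 * fls_nth (\<Prod>u\<in>#replicate_mset k u. cth 1 (u * v)) (-1)" if "v \<in> V" for v
    proof -
      have uv: "u * v \<noteq> 0" using that V less.prems 4 by auto
      define X where "X = cth 1 (u * v)"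
      have X': "X * X = fls_const (1 / 4) - fls_deriv X"
        using fls_deriv_cth[OF uv] by (simp add: X_def)
      \<comment> \<open>Up to the factor k + 1 the unwanted term is a derivative, and derivatives of
        Laurent series have no residue.\<close>
      have "fls_nth (fls_deriv (X ^ Suc k)) (-1) = of_nat (Suc k) * fls_nth (X ^ k * fls_deriv X) (-1)"
        by (simp only: fls_deriv_power fls_of_nat diff_Suc_1 mult.assoc fls_mult_const_nth)
      then have 0: "fls_nth (X ^ k * fls_deriv X) (-1) = 0"
        by (simp only: fls_deriv_residue) (simp del: of_nat_Suc)
      have "(\<Prod>u\<in>#M. cth 1 (u * v)) = X ^ k * (X * X)"
        using 4 by (simp add: X_def mult_ac)
      also have "\<dots> = fls_const (1 / 4) * X ^ k - X ^ k * fls_deriv X"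
        by (simp add: X' algebra_simps)
      finally show ?thesis using 0 by (simp add: X_def)
    qed
    have "(\<Sum>v\<in>V. fls_nth (\<Prod>u\<in>#M. cth 1 (u * v)) (-1)) =
      1 / 4 * (\<Sum>v\<in>V. fls_nth (\<Prod>u\<in>#replicate_mset k u. cth 1 (u * v)) (-1))"
      unfolding sum_distrib_left by (intro sum.cong refl st)
    also have "\<dots> = 1 / 4 * ((1 / 2) ^ k - (-1 / 2) ^ k)"
      by (subst less.hyps) (use 4 less.prems in \<open>auto split: if_splits\<close>)
    finally show ?thesis using 4 by (simp add: field_simps)
  qed simp
qed

text \<open>
  With \<open>v exp t\<close> as the variable, the elements are rational functions;
  the last two arguments are their values at \<open>\<infinity>\<close> and \<open>0\<close>.
\<close>
inductive cth_alg :: "complex set \<Rightarrow> (complex \<Rightarrow> complex fls) \<Rightarrow> complex \<Rightarrow> complex \<Rightarrow> bool" for U where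
  const: "cth_alg U (\<lambda>_. fls_const c) c c"
| add: "cth_alg U F a b \<Longrightarrow> cth_alg U G a' b' \<Longrightarrow> cth_alg U (\<lambda>v. F v + G v) (a + a') (b + b')"
| gen: "u \<in> U \<Longrightarrow> cth_alg U F a b \<Longrightarrow> cth_alg U (\<lambda>v. cth 1 (u * v) * F v) (1 / 2 * a) (-1 / 2 * b)"

lemma cth_alg_scale: "cth_alg U F a b \<Longrightarrow> cth_alg U (\<lambda>v. fls_const c * F v) (c * a) (c * b)"
proof (induction rule: cth_alg.induct)
  case (const c')
  then show ?case using cth_alg.const[of U "c * c'"] by (simp add: fls_const_mult_const)
next
  case (add F a b G a' b')
  then show ?case using cth_alg.add[OF add.IH] by (simp add: distrib_left)
next
  case (gen u F a b)
  then show ?case using cth_alg.gen[OF gen.hyps(1) gen.IH] by (simp add: mult_ac)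
qed

lemma cth_alg_mult:
  assumes G: "cth_alg U G a' b'"
  shows "cth_alg U F a b \<Longrightarrow> cth_alg U (\<lambda>v. F v * G v) (a * a') (b * b')"
proof (induction rule: cth_alg.induct)
  case (const c)
  then show ?case using cth_alg_scale[OF G] by simp
next
  case (add F a b F' a' b')
  then show ?case using cth_alg.add[OF add.IH] by (simp add: distrib_right)
next
  case (gen u F a b)
  then show ?case using cth_alg.gen[OF gen.hyps(1) gen.IH] by (simp add: mult_ac)
qed

lemma cth_alg_sum:
  "finite A \<Longrightarrow> (\<And>x. x \<in> A \<Longrightarrow> cth_alg U (F x) (a x) (b x)) \<Longrightarrow>
    cth_alg U (\<lambda>v. \<Sum>x\<in>A. F x v) (sum a A) (sum b A)"
  by (induction A rule: finite_induct) (use cth_alg.const[of U 0] in \<open>auto intro: cth_alg.add\<close>)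

lemma cth_alg_prod:
  "finite A \<Longrightarrow> (\<And>x. x \<in> A \<Longrightarrow> cth_alg U (F x) (a x) (b x)) \<Longrightarrow>
    cth_alg U (\<lambda>v. \<Prod>x\<in>A. F x v) (prod a A) (prod b A)"
  by (induction A rule: finite_induct) (use cth_alg.const[of U 1] in \<open>auto intro: cth_alg_mult\<close>)

lemma cth_alg_gen: "u \<in> U \<Longrightarrow> cth_alg U (\<lambda>v. cth 1 (u * v)) (1 / 2) (-1 / 2)"
  using cth_alg.gen[OF _ cth_alg.const[of U 1]] by simp

text \<open>The derivative vanishes at both ends because \<open>x\<^sup>2 = 1 / 4\<close> for \<open>x = \<plusminus>1 / 2\<close>.\<close>
lemma cth_alg_deriv:
  assumes "cth_alg U F a b"
  shows "\<exists>G. cth_alg U G 0 0 \<and> (\<forall>v. (\<forall>u\<in>U. u * v \<noteq> 0) \<longrightarrow> G v = fls_deriv (F v))"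
  using assms
proof induction
  case (const c)
  show ?case by (rule exI[of _ "\<lambda>_. fls_const 0"]) (use cth_alg.const[of U 0] in simp)
next
  case (add F a b G a' b')
  then obtain F' G' where "cth_alg U F' 0 0" "cth_alg U G' 0 0"
    "\<forall>v. (\<forall>u\<in>U. u * v \<noteq> 0) \<longrightarrow> F' v = fls_deriv (F v)"
    "\<forall>v. (\<forall>u\<in>U. u * v \<noteq> 0) \<longrightarrow> G' v = fls_deriv (G v)" by blast
  then show ?case using cth_alg.add[of U F' 0 0 G' 0 0] by (intro exI[of _ "\<lambda>v. F' v + G' v"]) simp
next
  case (gen u F a b)
  then obtain F' where F': "cth_alg U F' 0 0"
    "\<forall>v. (\<forall>u\<in>U. u * v \<noteq> 0) \<longrightarrow> F' v = fls_deriv (F v)" by blast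
  have sq: "cth_alg U (\<lambda>v. cth 1 (u * v) * cth 1 (u * v)) (1 / 4) (1 / 4)"
    using cth_alg.gen[OF gen.hyps(1) cth_alg_gen[OF gen.hyps(1)]] by simp
  have "cth_alg U (\<lambda>v. fls_const (1 / 4) + fls_const (-1) * (cth 1 (u * v) * cth 1 (u * v))) 0 0"
    using cth_alg.add[OF cth_alg.const[of U "1 / 4"] cth_alg_scale[OF sq, of "-1"]] by simp
  from cth_alg.add[OF cth_alg.gen[OF gen.hyps(1) F'(1)] cth_alg_mult[OF gen.hyps(2) this]]
  show ?case
    by (intro exI[of _ "\<lambda>v. cth 1 (u * v) * F' v + (fls_const (1 / 4) + fls_const (-1) * (cth 1 (u * v) * cth 1 (u * v))) * F v"])
      (use F'(2) gen.hyps(1) in \<open>auto simp: fls_deriv_cth algebra_simps\<close>)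
qed

lemma sum_residue_cth_alg:
  assumes V: "finite V" "0 \<notin> V" and U: "\<forall>u\<in>U. u \<noteq> 0 \<and> inverse u \<in> V"
    and F: "cth_alg U F a b"
  shows "(\<Sum>v\<in>V. fls_nth (F v) (-1)) = a - b"
proof -
  \<comment> \<open>The additional factors from \<open>M\<close> generalize the claim so that the
    \<open>gen\<close> step can absorb its generator into \<open>M\<close>.\<close>
  have "(\<Sum>v\<in>V. fls_nth (F v * (\<Prod>u\<in>#M. cth 1 (u * v))) (-1)) =
      a * (1 / 2) ^ size M - b * (-1 / 2) ^ size M" if "set_mset M \<subseteq> U" for M
    using F that
  proof (induction arbitrary: M)
    case (const c)
    then have "\<forall>u\<in>#M. u \<noteq> 0 \<and> inverse u \<in> V" using U by auto
    from sum_residue_prod_cth[OF V this] show ?case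
      by (simp add: right_diff_distrib flip: sum_distrib_left)
  next
    case (add F a b G a' b')
    show ?case using add.IH[OF add.prems] by (simp add: distrib_right sum.distrib)
  next
    case (gen u F a b)
    then show ?case using gen.IH[of "add_mset u M"] by (simp add: mult_ac)
  qed
  from this[of "{#}"] show ?thesis by simp
qed

subsection \<open>Reciprocity\<close>

lemma cth_alg_funpow_deriv:
  assumes "cth_alg U F a b"
  shows "\<exists>G. cth_alg U G (if s = 0 then a else 0) (if s = 0 then b else 0) \<and>
    (\<forall>v. (\<forall>u\<in>U. u * v \<noteq> 0) \<longrightarrow> G v = (fls_deriv ^^ s) (F v))"
proof (induction s)
  case 0
  then show ?case using assms by auto
next
  case (Suc s)
  then obtain G where G: "cth_alg U G (if s = 0 then a else 0) (if s = 0 then b else 0)"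
    "\<forall>v. (\<forall>u\<in>U. u * v \<noteq> 0) \<longrightarrow> G v = (fls_deriv ^^ s) (F v)" by blast
  from cth_alg_deriv[OF G(1)] G(2) show ?case by auto
qed

lemma fls_nth_funpow_deriv:
  "fls_nth ((fls_deriv ^^ s) F) k = pochhammer (of_int k + 1) s * fls_nth F (k + int s)"
  by (induction s arbitrary: k) (simp_all add: pochhammer_rec mult_ac add_ac)

text \<open>For {1..n} these are the weak compositions. Other index sets occur because indices are
  adjoined and removed below.\<close>

definition comps :: "'i set \<Rightarrow> nat \<Rightarrow> ('i \<Rightarrow> nat) set" where
  "comps A s = {m \<in> A \<rightarrow>\<^sub>E {..s}. sum m A = s}"

lemma finite_comps: "finite A \<Longrightarrow> finite (comps A s)"
  unfolding comps_def by (simp add: finite_PiE)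

lemma compsI: "finite A \<Longrightarrow> m \<in> extensional A \<Longrightarrow> sum m A = s \<Longrightarrow> m \<in> comps A s"
  unfolding comps_def by (auto simp: PiE_def intro: member_le_sum)

lemma fps_nth_prod_comps:
  assumes "finite A"
  shows "fps_nth (\<Prod>j\<in>A. G j) s = (\<Sum>m\<in>comps A s. \<Prod>j\<in>A. fps_nth (G j) (m j))"
  using assms
proof (induction A arbitrary: s rule: finite_induct)
  case empty
  show ?case by (cases "s = 0") (simp_all add: comps_def)
next
  case (insert a A)
  have "fps_nth (\<Prod>j\<in>insert a A. G j) s =
    (\<Sum>i=0..s. \<Sum>m\<in>comps A (s - i). fps_nth (G a) i * (\<Prod>j\<in>A. fps_nth (G j) (m j)))"
    using insert by (simp add: fps_mult_nth sum_distrib_left)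
  also have "\<dots> = (\<Sum>(i, m)\<in>(SIGMA i:{0..s}. comps A (s - i)). fps_nth (G a) i * (\<Prod>j\<in>A. fps_nth (G j) (m j)))"
    using insert.hyps by (subst sum.Sigma) (auto simp: finite_comps)
  also have "\<dots> = (\<Sum>m\<in>comps (insert a A) s. \<Prod>j\<in>insert a A. fps_nth (G j) (m j))"
  proof (rule sum.reindex_bij_witness[of _ "\<lambda>m. (m a, restrict m A)" "\<lambda>(i, m). m(a := i)"], goal_cases)
    case (1 x)
    then show ?case using insert.hyps by (auto simp: comps_def PiE_def extensional_def fun_eq_iff)
  next
    case (2 x)
    obtain i m where x: "x = (i, m)" by force
    have "sum (m(a := i)) A = sum m A" using insert.hyps by (intro sum.cong) auto
    then show ?case using 2 insert.hyps x
      by (intro compsI) (auto simp: comps_def PiE_def extensional_def)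
  next
    case (3 m)
    then show ?case by (auto simp: comps_def PiE_def extensional_def fun_eq_iff)
  next
    case (4 m)
    then have "m a + sum m A = s" using insert.hyps by (simp add: comps_def)
    then show ?case using insert.hyps by (auto intro!: compsI)
  next
    case (5 x)
    obtain i m where x: "x = (i, m)" by force
    have "(\<Prod>j\<in>A. fps_nth (G j) ((m(a := i)) j)) = (\<Prod>j\<in>A. fps_nth (G j) (m j))"
      using insert.hyps by (intro prod.cong) auto
    then show ?case using insert.hyps x by simp
  qed
  finally show ?case .
qed

text \<open>The binomial coefficient times the power of p_i in the theorem. \<open>gchoose\<close>
  gives the value (-1)^(r-1) at m = 0, which belongs to the polar term, and the exponent m - r may
  be negative.\<close>

definition rcoef :: "nat \<Rightarrow> nat \<Rightarrow> nat \<Rightarrow> complex" where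
  "rcoef r p m = ((of_nat m - 1) gchoose (r - 1)) * of_nat p powi (int m - int r)"

text \<open>Termwise differentiation of p^(m-1) \<open>bern m u\<close> t^(m-1). The normalization
  makes the coefficient of \<open>bern r u\<close> equal to 1.\<close>

lemma funpow_deriv_cth:
  assumes "r \<ge> 1" "p > 0" "u \<noteq> 0"
  shows "fls_const (1 / (fact (r - 1) * of_nat p ^ (r - 1))) * (fls_deriv ^^ (r - 1)) (cth (of_nat p) u) =
    fls_shift (int r) (fps_to_fls (Abs_fps (\<lambda>m. rcoef r p m * bern m u)))"
proof (rule fls_eqI)
  fix k :: int
  let ?L = "fls_const (1 / (fact (r - 1) * of_nat p ^ (r - 1))) * (fls_deriv ^^ (r - 1)) (cth (of_nat p) u)"
  let ?R = "fls_shift (int r) (fps_to_fls (Abs_fps (\<lambda>m. rcoef r p m * bern m u)))"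
  have r: "int (r - 1) = int r - 1" using assms by simp
  have L: "fls_nth ?L k = pochhammer (of_int k + 1) (r - 1) / (fact (r - 1) * of_nat p ^ (r - 1)) *
    (of_nat p powi (k + int r - 1) * fls_nth (cth 1 u) (k + int r - 1))"
    using assms by (simp add: fls_nth_funpow_deriv r cth_nth[of "of_nat p"] algebra_simps)
  show "fls_nth ?L k = fls_nth ?R k"
  \<comment> \<open>Below this bound the index k + r - 1 is less than -1, beyond the at most simple
    pole of \<open>cth 1 u\<close>.\<close>
  proof (cases "k + int r < 0")
    case True
    then have "fls_nth (cth 1 u) (k + int r - 1) = 0" using assms by (intro cth_nth_less) auto
    then show ?thesis using True L by simp
  next
    case False
    then obtain m where m: "k + int r = int m" by (metis not_less nonneg_int_cases)
    have "k = int m - int r" using m by simp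
    then have k: "of_int k + 1 = (of_nat m - 1 - of_nat (r - 1) + 1 :: complex)"
      using assms(1) by (simp add: of_nat_diff)
    have pw: "of_nat p powi (int m - 1) = (of_nat p ^ (r - 1) * of_nat p powi (int m - int r) :: complex)"
      using assms(2) r by (simp flip: power_int_of_nat power_int_add)
    show ?thesis using assms(2) unfolding L m k pw
      by (simp add: m gbinomial_pochhammer' rcoef_def bern_def)
  qed
qed

lemma prod_fls_shift:
  fixes F :: "'i \<Rightarrow> complex fls" and G :: "'i \<Rightarrow> complex fps"
  assumes "finite A" "\<And>j. j \<in> A \<Longrightarrow> F j = fls_shift (int (r j)) (fps_to_fls (G j))"
  shows "(\<Prod>j\<in>A. F j) = fls_shift (int (sum r A)) (fps_to_fls (\<Prod>j\<in>A. G j))"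
  using assms
  by (induction A rule: finite_induct) (simp_all add: fls_times_fps_to_fls fls_shifted_times_simps add.commute)

text \<open>
  Both sides are the sum over all \<open>M\<close>-th roots of unity \<open>v\<close> of the residues of the product over \<open>j\<close> of
  the \<open>(r j - 1)\<close>-st derivatives of \<open>cth (p j) (v ^ p j)\<close>; the tuples \<open>m\<close> index its expansion.
\<close>
lemma bern_reciprocity:
  fixes A :: "'i set" and r p :: "'i \<Rightarrow> nat"
  assumes A: "finite A" "A \<noteq> {}" and rp: "\<And>j. j \<in> A \<Longrightarrow> r j \<ge> 1 \<and> p j > 0 \<and> p j dvd M" and M: "M > 0"
  shows "(\<Sum>m\<in>comps A (sum r A - 1). (\<Prod>j\<in>A. rcoef (r j) (p j) (m j)) *
      (\<Sum>z\<in>runity M. \<Prod>j\<in>A. bern (m j) (z ^ p j))) =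
    (if \<forall>j\<in>A. r j = 1 then (1 / 2) ^ card A - (-1 / 2) ^ card A else 0)"
proof -
  define c where "c j = 1 / (fact (r j - 1) * of_nat (p j) ^ (r j - 1)) * (1 :: complex)" for j
  \<comment> \<open>\<open>U\<close> is closed under inverses, so it serves both as the set of
    generators and as the set of points where residues are taken.\<close>
  define U where "U = runity M"
  have U0: "\<forall>u\<in>U. \<forall>v\<in>U. u * v \<noteq> 0" using runity_nonzero M unfolding U_def by force
  have "\<exists>F. cth_alg U F (if r j = 1 then 1 / 2 else 0) (if r j = 1 then -1 / 2 else 0) \<and>
    (\<forall>v\<in>U. F v = fls_const (c j) * (fls_deriv ^^ (r j - 1)) (cth (of_nat (p j)) (v ^ p j)))"
    if j: "j \<in> A" for j
  proof -
    let ?p = "p j"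
    have p: "?p > 0" "?p dvd M" "r j \<ge> 1" using rp j by auto
    then have sub: "runity ?p \<subseteq> U" unfolding U_def by (auto elim!: dvdE simp: power_mult)
    have "cth_alg U (\<lambda>v. \<Sum>z\<in>runity ?p. cth 1 (z * v)) (\<Sum>z\<in>runity ?p. 1 / 2) (\<Sum>z\<in>runity ?p. -1 / 2)"
      using sub p by (intro cth_alg_sum finite_runity cth_alg_gen) auto
    from cth_alg_scale[OF this, of "1 / of_nat ?p"] 
    have "cth_alg U (\<lambda>v. fls_const (1 / of_nat ?p) * (\<Sum>z\<in>runity ?p. cth 1 (z * v))) (1 / 2) (-1 / 2)"
      using p by (simp add: card_roots_unity_eq)
    from cth_alg_funpow_deriv[OF this, of "r j - 1"] obtain G where
      G: "cth_alg U G (if r j = 1 then 1 / 2 else 0) (if r j = 1 then -1 / 2 else 0)"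
        "\<forall>v. (\<forall>u\<in>U. u * v \<noteq> 0) \<longrightarrow>
          G v = (fls_deriv ^^ (r j - 1)) (fls_const (1 / of_nat ?p) * (\<Sum>z\<in>runity ?p. cth 1 (z * v)))"
      using p by (auto simp: diff_is_0_eq' split: if_splits)
    have G': "G v = (fls_deriv ^^ (r j - 1)) (cth (of_nat ?p) (v ^ ?p))" if "v \<in> U" for v
    proof -
      have "v \<noteq> 0" using that M by (auto simp: U_def power_0_left)
      then show ?thesis using G(2) U0 that p by (simp add: cth_distribution)
    qed
    show ?thesis
      by (rule exI[of _ "\<lambda>v. fls_const (c j) * G v"])
        (use cth_alg_scale[OF G(1), of "c j"] G' in \<open>auto simp: c_def split: if_splits\<close>)
  qed
  then obtain F where F: "\<And>j. j \<in> A \<Longrightarrow>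
      cth_alg U (F j) (if r j = 1 then 1 / 2 else 0) (if r j = 1 then -1 / 2 else 0)"
    "\<And>j v. j \<in> A \<Longrightarrow> v \<in> U \<Longrightarrow>
      F j v = fls_const (c j) * (fls_deriv ^^ (r j - 1)) (cth (of_nat (p j)) (v ^ p j))"
    by metis
  have "fls_nth (\<Prod>j\<in>A. F j v) (-1) =
      (\<Sum>m\<in>comps A (sum r A - 1). (\<Prod>j\<in>A. rcoef (r j) (p j) (m j)) * (\<Prod>j\<in>A. bern (m j) (v ^ p j)))"
    (is "_ = ?f v") if v: "v \<in> U" for v
  proof -
    have v0: "v \<noteq> 0" using v M by (auto simp: U_def power_0_left)
    have "sum r A > 0" by (rule sum_pos) (use A rp in force)+
    \<comment> \<open>Taking the residue of a series shifted by \<open>sum r A\<close> lowers the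
      weight by one.\<close>
    then have s: "-1 + int (sum r A) = int (sum r A - 1)" by simp
    have "(\<Prod>j\<in>A. F j v) = fls_shift (int (sum r A))
        (fps_to_fls (\<Prod>j\<in>A. Abs_fps (\<lambda>m. rcoef (r j) (p j) m * bern m (v ^ p j))))"
    proof (rule prod_fls_shift[OF A(1)])
      fix j assume j: "j \<in> A"
      show "F j v = fls_shift (int (r j)) (fps_to_fls (Abs_fps (\<lambda>m. rcoef (r j) (p j) m * bern m (v ^ p j))))"
        unfolding F(2)[OF j v] using rp[OF j] v0 by (subst funpow_deriv_cth[symmetric]) (simp_all add: c_def)
    qed
    then show ?thesis
      by (simp only: fls_shift_nth s fps_to_fls_nth fps_nth_prod_comps[OF A(1)]) (simp add: prod.distrib)
  qed
  then have "(\<Sum>v\<in>U. fls_nth (\<Prod>j\<in>A. F j v) (-1)) = (\<Sum>v\<in>U. ?f v)"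
    by (rule sum.cong[OF refl])
  also have "\<dots> = (\<Sum>m\<in>comps A (sum r A - 1). (\<Prod>j\<in>A. rcoef (r j) (p j) (m j)) *
      (\<Sum>z\<in>runity M. \<Prod>j\<in>A. bern (m j) (z ^ p j)))"
    unfolding U_def sum_distrib_left by (rule sum.swap)
  finally have eq1: "(\<Sum>v\<in>U. fls_nth (\<Prod>j\<in>A. F j v) (-1)) =
    (\<Sum>m\<in>comps A (sum r A - 1). (\<Prod>j\<in>A. rcoef (r j) (p j) (m j)) *
      (\<Sum>z\<in>runity M. \<Prod>j\<in>A. bern (m j) (z ^ p j)))" .
  have eq2: "(\<Sum>v\<in>U. fls_nth (\<Prod>j\<in>A. F j v) (-1)) =
    (\<Prod>j\<in>A. if r j = 1 then 1 / 2 else 0) - (\<Prod>j\<in>A. if r j = 1 then -1 / 2 else 0)"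
  proof (rule sum_residue_cth_alg)
    show "cth_alg U (\<lambda>v. \<Prod>j\<in>A. F j v) (\<Prod>j\<in>A. if r j = 1 then 1 / 2 else 0) (\<Prod>j\<in>A. if r j = 1 then -1 / 2 else 0)"
      by (rule cth_alg_prod[OF A(1) F(1)])
    show "finite U" "0 \<notin> U" using M by (auto simp: U_def finite_runity power_0_left)
    show "\<forall>u\<in>U. u \<noteq> 0 \<and> inverse u \<in> U" using M by (auto simp: U_def power_inverse power_0_left)
  qed
  \<comment> \<open>A factor that is differentiated at least once vanishes at both ends, so the
    boundary term survives only if no factor is.\<close>
  have eq3: "(\<Prod>j\<in>A. if r j = 1 then x else 0) = (if \<forall>j\<in>A. r j = 1 then x ^ card A else 0)" for x :: complex
    using A(1) by (auto intro: prod_zero)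
  show ?thesis unfolding eq1[symmetric] eq2 eq3 by simp
qed

section \<open>Sums over roots of unity and the reduction of their order\<close>

definition bern_sum :: "nat \<Rightarrow> 'i set \<Rightarrow> ('i \<Rightarrow> nat) \<Rightarrow> ('i \<Rightarrow> nat) \<Rightarrow> complex" where
  "bern_sum g A m p = (\<Sum>z\<in>runity g. \<Prod>j\<in>A. bern (m j) (z ^ p j))"

lemma bern_sum_cong:
  assumes "\<And>j. j \<in> A \<Longrightarrow> m j = m' j" "\<And>j. j \<in> A \<Longrightarrow> p j = p' j" "A = A'"
  shows "bern_sum g A m p = bern_sum g A' m' p'"
  unfolding bern_sum_def using assms by (intro sum.cong prod.cong) auto

lemma power_gcd_eq_1:
  fixes z :: complex
  assumes "z ^ a = 1" "z ^ b = 1"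
  shows "z ^ gcd a b = 1"
proof (cases "a = 0")
  case False
  then obtain x y where xy: "a * x = b * y + gcd a b" using bezout_nat by blast
  have "z ^ (a * x) = 1" "z ^ (b * y) = 1" using assms by (simp_all add: power_mult)
  then show ?thesis using xy by (simp add: power_add)
qed (use assms in simp)

lemma power_Gcd_eq_1_iff:
  fixes z :: complex
  assumes "finite K"
  shows "z ^ Gcd (p ` K) = 1 \<longleftrightarrow> (\<forall>j\<in>K. z ^ p j = 1)"
proof
  assume z: "z ^ Gcd (p ` K) = 1"
  show "\<forall>j\<in>K. z ^ p j = 1"
  proof
    fix j assume "j \<in> K"
    then have "Gcd (p ` K) dvd p j" by auto
    then obtain c where c: "p j = Gcd (p ` K) * c" by (elim dvdE)
    show "z ^ p j = 1" unfolding c power_mult z by simp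
  qed
next
  show "\<forall>j\<in>K. z ^ p j = 1 \<Longrightarrow> z ^ Gcd (p ` K) = 1"
    using assms by (induction K rule: finite_induct) (auto intro: power_gcd_eq_1)
qed

text \<open>\<open>bern 0\<close> is the indicator function of \<open>1\<close>, so indices with \<open>m j = 0\<close> only restrict the summation.\<close>
lemma bern_sum_remove_zeros:
  assumes "finite B" "M > 0" "\<And>j. j \<in> B \<Longrightarrow> p j dvd M" "\<exists>j\<in>B. m j = 0"
  shows "bern_sum M B m p = bern_sum (Gcd (p ` {j\<in>B. m j = 0})) {j\<in>B. m j \<noteq> 0} m p"
proof -
  define K where "K = {j\<in>B. m j = 0}"
  have K: "finite K" "K \<noteq> {}" "K \<subseteq> B" using assms by (auto simp: K_def)
  have "Gcd (p ` K) dvd M"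
    using K assms(3) by (metis Gcd_dvd dvd_trans equals0I imageI subsetD)
  then have sub: "runity (Gcd (p ` K)) \<subseteq> runity M" by (auto elim!: dvdE simp: power_mult)
  have "bern_sum M B m p = (\<Sum>z\<in>runity M. if z ^ Gcd (p ` K) = 1 then \<Prod>j\<in>{j\<in>B. m j \<noteq> 0}. bern (m j) (z ^ p j) else 0)"
    unfolding bern_sum_def
  proof (intro sum.cong refl)
    fix z assume "z \<in> runity M"
    then have "z \<noteq> 0" using assms(2) by (auto simp: power_0_left)
    then have z: "bern 0 (z ^ p j) = (if z ^ p j = 1 then 1 else 0)" for j by (intro bern_0) simp
    have "B = K \<union> {j\<in>B. m j \<noteq> 0}" "K \<inter> {j\<in>B. m j \<noteq> 0} = {}" by (auto simp: K_def)
    then have "(\<Prod>j\<in>B. bern (m j) (z ^ p j)) =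
        (\<Prod>j\<in>K. bern (m j) (z ^ p j)) * (\<Prod>j\<in>{j\<in>B. m j \<noteq> 0}. bern (m j) (z ^ p j))"
      using K assms(1) by (metis (no_types, lifting) finite_Un prod.union_disjoint)
    also have "(\<Prod>j\<in>K. bern (m j) (z ^ p j)) = (\<Prod>j\<in>K. if z ^ p j = 1 then 1 else 0)"
      by (intro prod.cong refl) (simp add: K_def z)
    also have "\<dots> = (if z ^ Gcd (p ` K) = 1 then 1 else 0)"
      using K by (auto simp: power_Gcd_eq_1_iff intro: prod_zero)
    finally show "(\<Prod>j\<in>B. bern (m j) (z ^ p j)) = (if z ^ Gcd (p ` K) = 1
      then \<Prod>j\<in>{j\<in>B. m j \<noteq> 0}. bern (m j) (z ^ p j) else 0)" by simp
  qed
  also have "\<dots> = (\<Sum>z\<in>runity (Gcd (p ` K)). \<Prod>j\<in>{j\<in>B. m j \<noteq> 0}. bern (m j) (z ^ p j))"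
  proof (rule sum.mono_neutral_cong_right[OF finite_runity[OF assms(2)] sub])
    show "\<forall>z\<in>runity M - runity (Gcd (p ` K)). (if z ^ Gcd (p ` K) = 1
      then \<Prod>j\<in>{j\<in>B. m j \<noteq> 0}. bern (m j) (z ^ p j) else 0) = 0" by auto
  qed auto
  finally show ?thesis unfolding bern_sum_def K_def .
qed

text \<open>The binomial coefficient (m-1 choose r-1) vanishes because 0 \<le> m - 1 < r - 1. So a
  tuple contributes only if each entry is 0 or at least \<open>r j\<close>.\<close>

lemma rcoef_eq_0: "0 < m \<Longrightarrow> m < r \<Longrightarrow> rcoef r p m = 0"
proof -
  assume "0 < m" "m < r"
  moreover from this have "(of_nat m - 1 :: complex) = of_nat (m - 1)" by (simp add: of_nat_diff)
  ultimately show ?thesis by (simp only: rcoef_def binomial_gbinomial[symmetric]) (simp add: diff_less_mono)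
qed

lemma rcoef_self: "r \<ge> 1 \<Longrightarrow> rcoef r p r = 1"
proof -
  assume "r \<ge> 1"
  then have "(of_nat r - 1 :: complex) = of_nat (r - 1)" by (simp add: of_nat_diff)
  then show ?thesis by (simp add: rcoef_def binomial_gbinomial[symmetric])
qed

lemma gbinomial_pred_Ints: "((of_nat m - 1) gchoose k) \<in> (\<int> :: complex set)"
proof (cases "m = 0")
  case True
  have "((-1) gchoose k) = (-1 :: complex) ^ k * (of_nat k gchoose k)"
    using gbinomial_minus[of "1 :: complex" k] by simp
  also have "\<dots> = (-1) ^ k" by (simp add: binomial_gbinomial[symmetric])
  finally show ?thesis using True by simp
next
  case False
  then have "(of_nat m - 1 :: complex) = of_nat (m - 1)" by (simp add: of_nat_diff)
  then show ?thesis by (simp add: binomial_gbinomial[symmetric])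
qed

text \<open>\<open>bern_reciprocity\<close> is applied to \<open>A\<close> and a new index
  \<open>x\<close> of order \<open>g\<close> with exponent 1, which restores the weight
  \<open>sum r A\<close>. If \<open>m\<close> has no zero in \<open>A\<close>, a nonzero coefficient
  forces \<open>m j\<close> \<ge> \<open>r j\<close>; equal weights then give \<open>m j\<close> =
  \<open>r j\<close> and \<open>m x\<close> = 0, and this term is the left side. Every other
  contributing term has a zero in \<open>A\<close>, hence an order dividing some
  \<open>p j\<close>.\<close>

lemma bern_sum_reciprocity:
  fixes A :: "'i set" and r p :: "'i \<Rightarrow> nat"
  assumes A: "finite A" "x \<notin> A" and rp: "\<And>j. j \<in> A \<Longrightarrow> r j \<ge> 1 \<and> p j > 0" and g: "g > 0"
  shows "bern_sum g A r p = of_nat g *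
      (if \<forall>j\<in>A. r j = 1 then (1 / 2) ^ Suc (card A) - (-1 / 2) ^ Suc (card A) else 0) -
    (\<Sum>m\<in>{m\<in>comps (insert x A) (sum r A). \<exists>j\<in>A. m j = 0}.
       of_nat g ^ m x * (\<Prod>j\<in>A. rcoef (r j) (p j) (m j)) *
       bern_sum (Gcd ((p(x := g)) ` {j\<in>insert x A. m j = 0})) {j\<in>insert x A. m j \<noteq> 0} m (p(x := g)))"
proof -
  define B r' p' where "B = insert x A" and "r' = r(x := 1)" and "p' = p(x := g)"
  define M where "M = (\<Prod>j\<in>B. p' j)"
  have B: "finite B" "B \<noteq> {}" using A by (auto simp: B_def)
  have p': "p' j > 0" if "j \<in> B" for j using that rp g A by (auto simp: p'_def B_def)
  have M: "M > 0" "p' j dvd M" if "j \<in> B" for j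
    using p' B that by (auto simp: M_def intro!: prod_pos dvd_prodI)
  have M0: "M > 0" using p' by (auto simp: M_def intro!: prod_pos)
  have sr': "sum r' A = sum r A" unfolding r'_def using A by (intro sum.cong) auto
  then have sr: "sum r' B - 1 = sum r A" using A by (simp add: B_def r'_def)
  define f where "f m = (\<Prod>j\<in>B. rcoef (r' j) (p' j) (m j)) * bern_sum M B m p'" for m
  define E :: complex where "E = (if \<forall>j\<in>A. r j = 1 then (1 / 2) ^ Suc (card A) - (-1 / 2) ^ Suc (card A) else 0)"
  have allB: "(\<forall>j\<in>B. r' j = 1) \<longleftrightarrow> (\<forall>j\<in>A. r j = 1)" using A by (auto simp: B_def r'_def)
  have cardB: "card B = Suc (card A)" using A by (simp add: B_def)
  have "r' j \<ge> 1 \<and> p' j > 0 \<and> p' j dvd M" if "j \<in> B" for j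
    using that p' M(2) rp by (auto simp: B_def r'_def)
  from bern_reciprocity[of B r' p' M, OF B this M0] have recip: "(\<Sum>m\<in>comps B (sum r A). f m) = E"
    unfolding sr allB cardB f_def bern_sum_def E_def .
  define T where "T = {m\<in>comps B (sum r A). \<exists>j\<in>A. m j = 0}"
  \<comment> \<open>The one contributing tuple without a zero in \<open>A\<close>; its only zero is
    at \<open>x\<close>, so its order is \<open>g\<close>.\<close>
  define m0 where "m0 = restrict (r(x := 0)) B"
  have f_eq: "f m = of_nat g powi (int (m x) - 1) * (\<Prod>j\<in>A. rcoef (r j) (p j) (m j)) * bern_sum M B m p'" for m
  proof -
    have "(\<Prod>j\<in>A. rcoef (r' j) (p' j) (m j)) = (\<Prod>j\<in>A. rcoef (r j) (p j) (m j))"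
      unfolding r'_def p'_def using A by (intro prod.cong) auto
    then show ?thesis using A by (simp add: f_def B_def) (simp add: r'_def p'_def rcoef_def)
  qed
  have m0x: "m0 x = 0" by (simp add: m0_def B_def)
  have m0: "m0 \<in> comps B (sum r A)" "m0 \<notin> T"
  proof -
    have "sum m0 A = sum r A" using A by (intro sum.cong) (auto simp: m0_def B_def)
    then have "sum m0 B = sum r A" using A m0x sum.insert[OF A, of m0] by (simp add: B_def)
    then show "m0 \<in> comps B (sum r A)" using B by (intro compsI) (auto simp: m0_def)
    have "m0 j \<noteq> 0" if "j \<in> A" for j
      using that A(2) rp[OF that] by (auto simp: m0_def B_def)
    then show "m0 \<notin> T" by (auto simp: T_def)
  qed
  have fm0: "of_nat g * f m0 = bern_sum g A r p"
  proof -
    have K: "{j\<in>B. m0 j = 0} = {x}" "{j\<in>B. m0 j \<noteq> 0} = A"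
      using A rp by (force simp: m0_def B_def)+
    have "bern_sum M B m0 p' = bern_sum g A m0 p'"
      using bern_sum_remove_zeros[of B M p' m0, OF B(1) M0 M(2)] K unfolding K by (auto simp: p'_def m0_def B_def)
    also have "\<dots> = bern_sum g A r p" using A by (intro bern_sum_cong) (auto simp: m0_def B_def p'_def)
    finally have 1: "bern_sum M B m0 p' = bern_sum g A r p" .
    have 2: "(\<Prod>j\<in>A. rcoef (r j) (p j) (m0 j)) = 1"
      using A rp by (intro prod.neutral) (auto simp: m0_def B_def rcoef_self)
    show ?thesis unfolding f_eq 1 2 using g by (simp add: m0_def B_def power_int_minus)
  qed
  have f0: "f m = 0" if m: "m \<in> comps B (sum r A)" "m \<notin> T" "m \<noteq> m0" for m
  proof (rule ccontr)
    assume "f m \<noteq> 0"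
    then have nz: "\<forall>j\<in>A. rcoef (r j) (p j) (m j) \<noteq> 0" using A by (auto simp: f_eq)
    have ge: "m j \<ge> r j" if "j \<in> A" for j
      using nz that m(1,2) rcoef_eq_0[of "m j" "r j" "p j"] by (force simp: T_def)
    have s: "m x + sum m A = sum r A" using m(1) A by (simp add: comps_def B_def)
    moreover have "sum r A \<le> sum m A" using ge by (rule sum_mono)
    ultimately have mx: "m x = 0" and sm: "sum m A = sum r A" by auto
    have "m j = r j" if j: "j \<in> A" for j
    proof (rule ccontr)
      assume "m j \<noteq> r j"
      then have "r j < m j" using ge[OF j] by simp
      then have "sum r A < sum m A" using ge j A by (intro sum_strict_mono_ex1) auto
      then show False using sm by simp
    qed
    then have "m = m0" using mx m(1) A
      by (auto simp: m0_def B_def comps_def fun_eq_iff restrict_def PiE_def extensional_def)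
    with m(3) show False by simp
  qed
  have fin: "finite (comps B (sum r A))" using B by (simp add: finite_comps)
  have "(\<Sum>m\<in>comps B (sum r A). f m) = (\<Sum>m\<in>insert m0 T. f m)"
    by (rule sum.mono_neutral_right) (use fin m0 f0 in \<open>auto simp: T_def\<close>)
  also have "\<dots> = f m0 + sum f T" using m0 fin by (simp add: T_def)
  finally have "E = f m0 + sum f T" using recip by simp
  then have "bern_sum g A r p = of_nat g * E - (\<Sum>m\<in>T. of_nat g * f m)"
    using fm0 by (simp add: algebra_simps sum_distrib_left)
  also have "(\<Sum>m\<in>T. of_nat g * f m) = (\<Sum>m\<in>T. of_nat g ^ m x * (\<Prod>j\<in>A. rcoef (r j) (p j) (m j)) *
       bern_sum (Gcd (p' ` {j\<in>B. m j = 0})) {j\<in>B. m j \<noteq> 0} m p')"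
  proof (intro sum.cong refl)
    fix m assume "m \<in> T"
    then have "\<exists>j\<in>B. m j = 0" by (auto simp: T_def B_def)
    from bern_sum_remove_zeros[of B M p' m, OF B(1) M0 M(2) this]
    have 1: "bern_sum M B m p' = bern_sum (Gcd (p' ` {j\<in>B. m j = 0})) {j\<in>B. m j \<noteq> 0} m p'" by simp
    \<comment> \<open>The factor at \<open>x\<close> is g^(m x - 1); after multiplication by
      \<open>g\<close> all terms with \<open>m x\<close> > 0 keep a factor \<open>g\<close>.\<close>
    have 2: "of_nat g * of_nat g powi (int (m x) - 1) = (of_nat g ^ m x :: complex)"
      using g by (simp add: power_int_diff)
    show "of_nat g * f m = of_nat g ^ m x * (\<Prod>j\<in>A. rcoef (r j) (p j) (m j)) *
       bern_sum (Gcd (p' ` {j\<in>B. m j = 0})) {j\<in>B. m j \<noteq> 0} m p'"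
      unfolding f_eq 1[symmetric] 2[symmetric] by simp
  qed
  finally show ?thesis unfolding E_def T_def B_def p'_def .
qed

subsection \<open>Integrality at a prime\<close>

text \<open>The localization of the integers at \<open>l\<close>, extended to complex numbers
  because the sums over roots of unity live there and are not known to be rational
  beforehand.\<close>

definition loc_int :: "nat \<Rightarrow> complex set" where
  "loc_int l = {x. \<exists>k :: int. \<not> int l dvd k \<and> of_int k * x \<in> \<int>}"

lemma loc_int_Ints: "prime l \<Longrightarrow> x \<in> \<int> \<Longrightarrow> x \<in> loc_int l"
  unfolding loc_int_def by (auto intro!: exI[of _ 1] simp: prime_nat_iff)

lemma loc_int_add:
  assumes l: "prime l" and "x \<in> loc_int l" "y \<in> loc_int l"
  shows "x + y \<in> loc_int l"
proof -
  obtain a b :: int where ab: "\<not> int l dvd a" "of_int a * x \<in> \<int>" "\<not> int l dvd b" "of_int b * y \<in> \<int>"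
    using assms(2,3) unfolding loc_int_def by blast
  have "of_int (a * b) * (x + y) = of_int b * (of_int a * x) + of_int a * (of_int b * y)"
    by (simp add: algebra_simps)
  also have "\<dots> \<in> \<int>" by (rule Ints_add[OF Ints_mult[OF Ints_of_int ab(2)] Ints_mult[OF Ints_of_int ab(4)]])
  finally show ?thesis using ab l by (auto simp: loc_int_def prime_dvd_mult_iff intro!: exI[of _ "a * b"])
qed

lemma loc_int_mult:
  assumes l: "prime l" and "x \<in> loc_int l" "y \<in> loc_int l"
  shows "x * y \<in> loc_int l"
proof -
  obtain a b :: int where ab: "\<not> int l dvd a" "of_int a * x \<in> \<int>" "\<not> int l dvd b" "of_int b * y \<in> \<int>"
    using assms(2,3) unfolding loc_int_def by blast
  have "of_int (a * b) * (x * y) = (of_int a * x) * (of_int b * y)"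
    by (simp add: algebra_simps)
  also have "\<dots> \<in> \<int>" using ab(2,4) by (rule Ints_mult)
  finally show ?thesis using ab l by (auto simp: loc_int_def prime_dvd_mult_iff intro!: exI[of _ "a * b"])
qed

lemma loc_int_minus: "prime l \<Longrightarrow> x \<in> loc_int l \<Longrightarrow> - x \<in> loc_int l"
  using loc_int_mult[of l "-1" x] loc_int_Ints[of l "-1"] by simp

lemma loc_int_diff: "prime l \<Longrightarrow> x \<in> loc_int l \<Longrightarrow> y \<in> loc_int l \<Longrightarrow> x - y \<in> loc_int l"
  using loc_int_add[of l x "-y"] loc_int_minus by simp

lemma loc_int_sum: "prime l \<Longrightarrow> (\<And>i. i \<in> I \<Longrightarrow> f i \<in> loc_int l) \<Longrightarrow> sum f I \<in> loc_int l"
  by (induction I rule: infinite_finite_induct) (auto intro: loc_int_add loc_int_Ints)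

lemma loc_int_prod: "prime l \<Longrightarrow> (\<And>i. i \<in> I \<Longrightarrow> f i \<in> loc_int l) \<Longrightarrow> prod f I \<in> loc_int l"
  by (induction I rule: infinite_finite_induct) (auto intro: loc_int_mult loc_int_Ints)

lemma loc_int_powi:
  assumes l: "prime l" and p: "\<not> l dvd p"
  shows "of_nat p powi k \<in> loc_int l"
proof (cases "k \<ge> 0")
  case True
  then show ?thesis using l by (intro loc_int_Ints) (auto simp: power_int_def)
next
  case False
  have "p \<noteq> 0" using p by (intro notI) simp
  then have "of_int (int p ^ nat (- k)) * (of_nat p powi k) = (1 :: complex)"
    using False by (simp add: power_int_def power_inverse)
  moreover have "\<not> int l dvd int p ^ nat (- k)" using l p
    by (metis int_dvd_int_iff of_nat_power prime_dvd_power)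
  ultimately show ?thesis unfolding loc_int_def by (metis (mono_tags, lifting) Ints_1 mem_Collect_eq)
qed

text \<open>The integers k with k x integral form an ideal \<open>J\<close>. Its least positive
  element generates it and, by the assumption, has no prime factor.\<close>

lemma Ints_if_loc_int:
  assumes "\<And>l. prime l \<Longrightarrow> x \<in> loc_int l"
  shows "x \<in> \<int>"
proof -
  define J where "J = {k :: int. of_int k * x \<in> \<int>}"
  obtain l0 :: nat where "prime l0" using two_is_prime_nat by blast
  from assms[OF this] obtain k0 where k0: "k0 \<in> J" "k0 \<noteq> 0" by (auto simp: loc_int_def J_def)
  define a where "a = (LEAST a. a > 0 \<and> int a \<in> J)"
  have Jmult: "c * k \<in> J" if "k \<in> J" for k c using that by (auto simp: J_def mult.assoc intro: Ints_mult)
  have Jdiff: "j - k \<in> J" if "k \<in> J" "j \<in> J" for j k using that by (auto simp: J_def left_diff_distrib)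
  have "\<bar>k0\<bar> \<in> J" using Jmult[OF k0(1), of "sgn k0"] by (simp add: abs_sgn mult.commute)
  then have "nat \<bar>k0\<bar> > 0 \<and> int (nat \<bar>k0\<bar>) \<in> J" using k0(2) by simp
  then have a: "a > 0" "int a \<in> J" unfolding a_def by (metis (mono_tags, lifting) LeastI_ex)+
  have least: "b \<ge> a" if "b > 0" "int b \<in> J" for b unfolding a_def using that by (intro Least_le) simp
  have dvd: "int a dvd k" if k: "k \<in> J" for k
  proof (rule ccontr)
    assume "\<not> int a dvd k"
    then have "k mod int a \<noteq> 0" by auto
    then have "k mod int a > 0" "k mod int a < int a" using a(1)
      by (simp_all add: order_le_neq_trans)
    moreover have "k mod int a \<in> J"
      using Jdiff[OF Jmult[OF a(2), of "k div int a"] k] by (simp add: minus_div_mult_eq_mod)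
    ultimately show False using least[of "nat (k mod int a)"] by simp
  qed
  have "a = 1"
  proof (rule ccontr)
    assume "a \<noteq> 1"
    then obtain l where l: "prime l" "l dvd a" using prime_factor_nat by blast
    obtain k where "\<not> int l dvd k" "k \<in> J" using assms[OF l(1)] by (auto simp: loc_int_def J_def)
    with dvd l(2) show False by (meson dvd_trans int_dvd_int_iff)
  qed
  then show ?thesis using a by (simp add: J_def)
qed

text \<open>The property of \<open>d\<close> used in the induction, where the index set varies. Sets
  with fewer than \<open>n\<close> elements are allowed since indices with m = 0 get removed, at no
  cost because B_0 / 0! = 1.\<close>

definition clears_todd :: "int \<Rightarrow> nat \<Rightarrow> nat \<Rightarrow> bool" where
  "clears_todd d N n \<longleftrightarrow> (\<forall>(A :: nat set) m. finite A \<longrightarrow> card A \<le> n \<longrightarrow> sum m A = N \<longrightarrow>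
     of_int d * (\<Prod>j\<in>A. bernoulli (m j) / fact (m j)) \<in> (\<int> :: complex set))"

lemma prod_bern_at_1:
  assumes "finite A" "\<And>j. j \<in> A \<Longrightarrow> m j > 0"
  shows "(\<Prod>j\<in>A. bern (m j) 1) = (if \<exists>j\<in>A. m j = 1 then 0 else \<Prod>j\<in>A. bernoulli (m j) / fact (m j))"
proof (cases "\<exists>j\<in>A. m j = 1")
  case True
  then obtain j where "j \<in> A" "m j = 1" by blast
  moreover have "bern 1 1 = 0" by (simp add: bern_at_1 bernoulli_0_1 del: One_nat_def)
  ultimately have "\<exists>j\<in>A. bern (m j) 1 = 0" by metis
  then show ?thesis using True assms(1) by (simp add: prod_zero)
next
  case False
  then show ?thesis by (auto intro!: prod.cong simp: bern_at_1)
qed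

lemma rcoef_loc_int:
  assumes "prime l" "\<not> l dvd p"
  shows "rcoef r p m \<in> loc_int l"
  unfolding rcoef_def by (intro loc_int_mult loc_int_Ints loc_int_powi gbinomial_pred_Ints assms)

text \<open>For even k this is a product of k factors B_1 / 1!, so the boundary term of reciprocity
  is again a Bernoulli product or 0, and \<open>d\<close> clears it.\<close>

lemma half_power_diff:
  "(1 / 2) ^ Suc k - (-1 / 2) ^ Suc k = (if even k then (-1 / 2) ^ k else 0 :: complex)"
  by (auto simp: power_minus_odd field_simps)

text \<open>Strong induction on the order \<open>g\<close>. After the exponents are made prime to
  \<open>l\<close> and smaller than \<open>g\<close>, reciprocity has \<open>l\<close>-integral
  coefficients and expresses the sum through orders dividing some exponent, which are smaller than
  \<open>g\<close> and prime to \<open>l\<close>.\<close>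

lemma bern_sum_loc_int:
  fixes A :: "nat set"
  assumes l: "prime l" and d: "clears_todd d N n"
    and "g > 0" "\<not> l dvd g" "finite A" "card A \<le> n" "\<And>j. j \<in> A \<Longrightarrow> m j > 0" "sum m A = N"
  shows "of_int d * bern_sum g A m p \<in> loc_int l"
  using assms(3-)
proof (induction g arbitrary: A m p rule: less_induct)
  case (less g A m p)
  note g = less.prems(1,2) and A = less.prems(3,4) and m = less.prems(5,6)
  \<comment> \<open>On \<open>A0\<close> the powers \<open>z ^ p j\<close> are 1, so these factors
    form a constant; they have no nonzero residue below \<open>g\<close> to offer to
    reciprocity.\<close>
  define A0 A1 where "A0 = {j\<in>A. g dvd p j}" and "A1 = A - A0"
  have A01: "A = A0 \<union> A1" "A0 \<inter> A1 = {}" "finite A0" "finite A1" using A by (auto simp: A0_def A1_def)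
  have cards: "card A = card A0 + card A1" using A01 by (simp add: card_Un_disjoint)
  have sums: "N = sum m A0 + sum m A1" using A01 m(2) by (simp add: sum.union_disjoint)
  \<comment> \<open>If \<open>l\<close> divides the residue it cannot divide \<open>g\<close> minus
    the residue, since \<open>l\<close> does not divide \<open>g\<close>. The change of sign in the
    exponent costs the factor \<open>e j\<close>, by oddness.\<close>
  define p' where "p' j = (if l dvd p j mod g then g - p j mod g else p j mod g)" for j
  define e :: "nat \<Rightarrow> complex" where "e j = (if l dvd p j mod g then (-1) ^ m j else 1)" for j
  have p': "0 < p' j" "p' j < g" "\<not> l dvd p' j" if "j \<in> A1" for j
  proof -
    have 1: "0 < p j mod g" "p j mod g < g" using that g by (auto simp: A1_def A0_def dvd_eq_mod_eq_0)
    then show "0 < p' j" "p' j < g" by (auto simp: p'_def)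
    have "\<not> l dvd g - p j mod g" if "l dvd p j mod g"
      using that 1(2) g(2) by (metis dvd_diffD less_imp_le)
    then show "\<not> l dvd p' j" by (auto simp: p'_def)
  qed
  have e: "bern (m j) (z ^ p j) = e j * bern (m j) (z ^ p' j)" if j: "j \<in> A" and z: "z ^ g = 1" for j z
  proof -
    have z0: "z \<noteq> 0" using z g by (auto simp: power_0_left)
    have zz: "z ^ p j = z ^ (p j mod g)"
      using z by (metis div_mult_mod_eq mult.commute mult_1 power_add power_mult power_one)
    have "z ^ (g - p j mod g) * z ^ (p j mod g) = 1" using z g by (simp flip: power_add)
    then have "z ^ (p j mod g) = inverse (z ^ (g - p j mod g))"
      by (metis inverse_unique)
    then show ?thesis using z0 m(1)[OF j] by (simp add: e_def p'_def zz bern_inverse)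
  qed
  define C where "C = (\<Prod>j\<in>A0. bern (m j) 1)"
  have "(\<Prod>j\<in>A. bern (m j) (z ^ p j)) = C * (\<Prod>j\<in>A1. e j) * (\<Prod>j\<in>A1. bern (m j) (z ^ p' j))"
    if z: "z ^ g = 1" for z
  proof -
    have "(\<Prod>j\<in>A0. bern (m j) (z ^ p j)) = C"
      unfolding C_def by (intro prod.cong refl) (use z in \<open>auto simp: A0_def power_mult elim!: dvdE\<close>)
    moreover have "(\<Prod>j\<in>A1. bern (m j) (z ^ p j)) = (\<Prod>j\<in>A1. e j * bern (m j) (z ^ p' j))"
      by (intro prod.cong refl e) (use z in \<open>auto simp: A1_def\<close>)
    ultimately show ?thesis using A01 by (simp add: prod.union_disjoint prod.distrib)
  qed
  then have S: "bern_sum g A m p = (\<Prod>j\<in>A1. e j) * (C * bern_sum g A1 m p')"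
    unfolding bern_sum_def sum_distrib_left by (intro sum.cong refl) (simp add: mult_ac)
  \<comment> \<open>This handles the boundary term \<open>E\<close>, which is the Bernoulli product
    over \<open>A1\<close> or 0.\<close>
  have dC: "of_int d * (C * (\<Prod>j\<in>A1. bernoulli (m j) / fact (m j))) \<in> \<int>"
  proof (cases "\<exists>j\<in>A0. m j = 1")
    case False
    then have "C * (\<Prod>j\<in>A1. bernoulli (m j) / fact (m j)) = (\<Prod>j\<in>A. bernoulli (m j) / fact (m j))"
      using A01 m(1) by (simp add: C_def prod_bern_at_1 prod.union_disjoint)
    then show ?thesis using d A m by (simp add: clears_todd_def)
  qed (use A01 m(1) in \<open>simp add: C_def prod_bern_at_1\<close>)
  obtain x where x: "x \<notin> A" using A ex_new_if_finite by blast
  define T where "T = {m'\<in>comps (insert x A1) (sum m A1). \<exists>j\<in>A1. m' j = 0}"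
  define E :: complex where "E = (if \<forall>j\<in>A1. m j = 1 then (1 / 2) ^ Suc (card A1) - (-1 / 2) ^ Suc (card A1) else 0)"
  define p2 where "p2 = p'(x := g)"
  let ?S = "\<lambda>m'. bern_sum (Gcd (p2 ` {j\<in>insert x A1. m' j = 0})) {j\<in>insert x A1. m' j \<noteq> 0} m' p2"
  have pre: "m j \<ge> 1 \<and> p' j > 0" if "j \<in> A1" for j
    using that m(1)[of j] p'(1)[of j] A01(1) by auto
  have "x \<notin> A1" using x A01 by auto
  note recip = bern_sum_reciprocity[of A1 x m p' g, OF A01(4) this pre g(1), folded E_def T_def p2_def]
  have "bern_sum g A1 m p' = of_nat g * E -
    (\<Sum>m'\<in>T. of_nat g ^ m' x * (\<Prod>j\<in>A1. rcoef (m j) (p' j) (m' j)) * ?S m')"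
    by (rule recip)
  then have "of_int d * (C * bern_sum g A1 m p') = of_nat g * (of_int d * (C * E)) -
    (\<Sum>m'\<in>T. of_nat g ^ m' x * (\<Prod>j\<in>A1. rcoef (m j) (p' j) (m' j)) * (of_int d * (C * ?S m')))"
    by (simp add: right_diff_distrib sum_distrib_left mult_ac)
  also have "\<dots> \<in> loc_int l"
  proof (rule loc_int_diff[OF l _ loc_int_sum[OF l]])
    have "E = (\<Prod>j\<in>A1. bernoulli (m j) / fact (m j)) \<or> E = 0"
    proof (cases "(\<forall>j\<in>A1. m j = 1) \<and> even (card A1)")
      case True
      then have "(\<Prod>j\<in>A1. bernoulli (m j) / fact (m j)) = (\<Prod>j\<in>A1. -1 / 2 :: complex)"
        by (intro prod.cong refl) (simp add: bernoulli_0_1 del: One_nat_def)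
      also have "\<dots> = E" unfolding E_def half_power_diff using True by simp
      finally show ?thesis by simp
    qed (auto simp only: E_def half_power_diff split: if_splits)
    then have "of_int d * (C * E) \<in> \<int>" using dC by auto
    then show "of_nat g * (of_int d * (C * E)) \<in> loc_int l" using l
      by (intro loc_int_Ints Ints_mult[OF Ints_of_nat])
  next
    fix m' assume m': "m' \<in> T"
    have "of_nat g ^ m' x \<in> loc_int l" using l by (intro loc_int_Ints) auto
    moreover have "(\<Prod>j\<in>A1. rcoef (m j) (p' j) (m' j)) \<in> loc_int l"
      using l p'(3) by (intro loc_int_prod rcoef_loc_int)
    ultimately have coef: "of_nat g ^ m' x * (\<Prod>j\<in>A1. rcoef (m j) (p' j) (m' j)) \<in> loc_int l"
      by (rule loc_int_mult[OF l])
    define K where "K = {j\<in>insert x A1. m' j = 0}"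
    define B where "B = {j\<in>insert x A1. m' j \<noteq> 0}"
    \<comment> \<open>The constant \<open>C\<close> is turned back into factors over
      \<open>A0\<close> with exponent 0, so that the induction hypothesis applies to a sum of full
      weight \<open>N\<close>.\<close>
    define m2 where "m2 j = (if j \<in> A0 then m j else m' j)" for j
    define p3 where "p3 j = (if j \<in> A0 then 0 else p2 j)" for j
    have x1: "x \<notin> A0" "x \<notin> A1" using x A01 by auto
    obtain i where i: "i \<in> A1" "m' i = 0" using m' by (auto simp: T_def)
    have KB: "insert x A1 = K \<union> B" "K \<inter> B = {}" "finite K" "finite B" "A0 \<inter> B = {}"
      using A01 x1 by (auto simp: K_def B_def)
    have "i \<in> K" using i by (auto simp: K_def)
    \<comment> \<open>The new index \<open>x\<close> is compensated by at least one removed index,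
      so the number of factors does not grow.\<close>
    then have cardK: "card K > 0" using KB by (auto simp: card_gt_0_iff)
    have cardKB: "Suc (card A1) = card K + card B"
      using card_Un_disjoint[of K B] KB x1 A01 by (metis card_insert_disjoint)
    define g' where "g' = Gcd (p2 ` K)"
    have "g' dvd p2 i" using \<open>i \<in> K\<close> by (auto simp: g'_def)
    then have gi: "g' dvd p' i" using i x1 by (auto simp: p2_def split: if_splits)
    have "g' > 0" using gi p'(1)[OF i(1)] by (rule dvd_pos_nat[rotated])
    moreover have "g' < g" using dvd_imp_le[OF gi p'(1)[OF i(1)]] p'(2)[OF i(1)] by simp
    moreover have "\<not> l dvd g'" using gi p'(3)[OF i(1)] dvd_trans by blast
    ultimately have g': "g' > 0" "g' < g" "\<not> l dvd g'" .
    have "of_int d * bern_sum g' (A0 \<union> B) m2 p3 \<in> loc_int l"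
    proof (rule less.IH)
      show "card (A0 \<union> B) \<le> n" using cards cardK cardKB A KB A01 by (simp add: card_Un_disjoint)
      have "sum m' (insert x A1) = sum m A1" using m' by (simp add: T_def comps_def)
      also have "sum m' (insert x A1) = sum m' B"
        by (rule sum.mono_neutral_right) (use KB A01 in \<open>auto simp: B_def\<close>)
      also have "sum m' B = sum m2 B" using KB by (intro sum.cong) (auto simp: m2_def)
      finally have "sum m2 B = sum m A1" .
      moreover have "sum m2 A0 = sum m A0" by (intro sum.cong) (auto simp: m2_def)
      ultimately show "sum m2 (A0 \<union> B) = N" using sums KB A01 by (simp add: sum.union_disjoint)
      show "finite (A0 \<union> B)" using A01(3) KB(4) by simp
      show "m2 j > 0" if "j \<in> A0 \<union> B" for j
        using that m(1)[of j] by (auto simp: m2_def B_def A0_def)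
    qed (fact g')+
    moreover have "bern_sum g' (A0 \<union> B) m2 p3 = C * bern_sum g' B m' p2"
    proof -
      have "(\<Prod>j\<in>A0. bern (m2 j) (z ^ p3 j)) = C" for z
        unfolding C_def by (intro prod.cong) (auto simp: m2_def p3_def)
      moreover have "(\<Prod>j\<in>B. bern (m2 j) (z ^ p3 j)) = (\<Prod>j\<in>B. bern (m' j) (z ^ p2 j))" for z
        using KB by (intro prod.cong) (auto simp: m2_def p3_def)
      ultimately show ?thesis using KB A01
        by (simp add: bern_sum_def prod.union_disjoint sum_distrib_left)
    qed
    ultimately have "of_int d * (C * ?S m') \<in> loc_int l" by (simp add: g'_def K_def B_def)
    then show "of_nat g ^ m' x * (\<Prod>j\<in>A1. rcoef (m j) (p' j) (m' j)) * (of_int d * (C * ?S m')) \<in> loc_int l"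
      by (rule loc_int_mult[OF l coef])
  qed
  finally have "of_int d * (C * bern_sum g A1 m p') \<in> loc_int l" .
  moreover have "(\<Prod>j\<in>A1. e j) \<in> loc_int l" using l
    by (intro loc_int_prod loc_int_Ints) (auto simp: e_def)
  ultimately have "(\<Prod>j\<in>A1. e j) * (of_int d * (C * bern_sum g A1 m p')) \<in> loc_int l"
    using loc_int_mult[OF l] by blast
  then show ?case by (simp add: S mult_ac)
qed

subsection \<open>The finite Fourier transform of the periodic Bernoulli functions\<close>

text \<open>Dedekind sums are real, Todd coefficients rational and the sums over roots of unity
  complex; this carries Bernoulli numbers between the fields. The image of the generating function
  satisfies the same equation, which has only one solution.\<close>

lemma bernpoly_hom:
  fixes h :: "'a :: field_char_0 \<Rightarrow> 'b :: field_char_0"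
  assumes add: "\<And>x y. h (x + y) = h x + h y" and mult: "\<And>x y. h (x * y) = h x * h y" and h1: "h 1 = 1"
  shows "bernpoly k (h x) = h (bernpoly k x)"
proof -
  have h0: "h 0 = 0" using add[of 0 0] by simp
  have nat: "h (of_nat n) = of_nat n" for n by (induction n) (simp_all add: h0 h1 add)
  have fact: "h (fact n) = fact n" for n using nat[of "fact n"] by simp
  have inv: "h (inverse (fact n)) = inverse (fact n)" for n
  proof -
    have "h (inverse (fact n)) * fact n = 1" using mult[of "inverse (fact n)" "fact n"] h1 fact by simp
    then show ?thesis by (simp add: field_simps)
  qed
  have power: "h (y ^ n) = h y ^ n" for y n by (induction n) (simp_all add: h1 mult)
  have sum: "h (sum f A) = (\<Sum>i\<in>A. h (f i))" for f :: "nat \<Rightarrow> 'a" and A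
    by (induction A rule: infinite_finite_induct) (simp_all add: h0 add)
  define e :: "nat \<Rightarrow> 'a" where "e n = fps_nth (fps_exp 1 - 1) n" for n
  have e: "h (e n) = fps_nth (fps_exp 1 - 1) n" for n
    by (cases n) (use inv[of n] in \<open>simp_all add: e_def h0 divide_inverse del: fact_Suc\<close>)
  have "Abs_fps (\<lambda>k. h (bernpoly k x / fact k)) * (fps_exp 1 - 1) = fps_X * fps_exp (h x)"
  proof (rule fps_ext)
    fix n
    have "fps_nth (Abs_fps (\<lambda>k. h (bernpoly k x / fact k)) * (fps_exp 1 - 1)) n =
        h (fps_nth (Abs_fps (\<lambda>k. bernpoly k x / fact k) * (fps_exp 1 - 1)) n)"
      by (simp only: fps_mult_nth sum mult fps_nth_Abs_fps e[symmetric] e_def)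
    also have "\<dots> = h (fps_nth (fps_X * fps_exp x) n)" by (simp only: bernpoly_egf)
    also have "\<dots> = fps_nth (fps_X * fps_exp (h x)) n"
      by (cases n) (simp_all add: h0 divide_inverse mult power inv del: fact_Suc)
    finally show "fps_nth (Abs_fps (\<lambda>k. h (bernpoly k x / fact k)) * (fps_exp 1 - 1)) n = \<dots>" .
  qed
  also have "\<dots> = Abs_fps (\<lambda>k. bernpoly k (h x) / fact k) * (fps_exp 1 - 1)"
    by (rule bernpoly_egf[symmetric])
  finally have eq: "Abs_fps (\<lambda>k. h (bernpoly k x / fact k)) * (fps_exp 1 - 1) =
    Abs_fps (\<lambda>k. bernpoly k (h x) / fact k) * (fps_exp 1 - 1)" .
  have nz: "fps_exp 1 - 1 \<noteq> (0 :: 'b fps)"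
  proof
    assume "fps_exp 1 - 1 = (0 :: 'b fps)"
    then have "fps_nth (fps_exp 1 - 1) 1 = (0 :: 'b)" by simp
    then show False by simp
  qed
  from arg_cong[OF mult_right_cancel[THEN iffD1, OF nz eq], of "\<lambda>F. fps_nth F k"]
  have "h (bernpoly k x) * inverse (fact k) = bernpoly k (h x) * inverse (fact k)"
    by (simp only: fps_nth_Abs_fps divide_inverse mult inv)
  then show ?thesis by simp
qed

lemma bernoulli_of_real: "(of_real (bernoulli k) :: complex) = bernoulli k"
  using bernpoly_hom[of "of_real :: real \<Rightarrow> complex" k 0] by (simp add: bernoulli_def)

lemma bernoulli_of_rat: "(of_rat (bernoulli k) :: complex) = bernoulli k"
  using bernpoly_hom[of "of_rat :: rat \<Rightarrow> complex" k 0] by (simp add: bernoulli_def of_rat_add of_rat_mult)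

text \<open>With x = exp t the sum of the \<open>cth 1 z\<close>, weighted by z^(-k), is q exp(k t)
  / (exp(q t) - 1) plus a constant. The quotient is the generating function of the Bernoulli
  polynomials at k / q in the variable q t, divided by t.\<close>

lemma sum_runity_bern:
  assumes q: "q > 0" and r: "r \<ge> 1" and k: "k < q"
  shows "(\<Sum>z\<in>runity q. bern r z * inverse z ^ k) = 
    of_nat q ^ r / fact r * of_real (pbernpoly r (of_nat k / of_nat q))"
proof -
  define x :: "complex fls" where "x = fps_to_fls (fps_exp 1)"
  have xp: "x ^ j = fps_to_fls (fps_exp (of_nat j))" for j
    by (simp add: x_def fps_exp_power_mult flip: fps_to_fls_power)
  define D :: "complex fps" where "D = fps_exp (of_nat q) - 1"
  have D: "D \<noteq> 0" using cth_denominator_nonzero[of "of_nat q" 1] q by (simp add: D_def)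
  have xq: "x ^ q - 1 = fps_to_fls D" by (simp add: xp D_def)
  then have xq1: "x ^ q \<noteq> 1" using D by auto
  define t :: complex where "t = of_nat k / of_nat q"
  define L where "L = fps_const (of_nat q) * (fps_X :: complex fps)"
  have L0: "fps_nth L 0 = 0" by (simp add: L_def)
  define F where "F = fps_compose (Abs_fps (\<lambda>j. bernpoly j t / fact j)) L"
  have "F * D = fps_compose (Abs_fps (\<lambda>j. bernpoly j t / fact j) * (fps_exp 1 - 1)) L"
    using L0 by (simp add: F_def fps_compose_mult_distrib D_def fps_compose_sub_distrib L_def)
  also have "\<dots> = L * fps_exp (of_nat k)"
    using L0 q by (simp add: bernpoly_egf fps_compose_mult_distrib L_def t_def)
  finally have FD: "fps_to_fls F * fps_to_fls D = of_nat q * fls_X * x ^ k"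
    by (metis L_def fls_times_fps_to_fls fps_X_to_fls fps_const_to_fls fls_of_nat xp)
  have "of_nat q * x ^ k * inverse (x ^ q - 1) = fls_X_inv * fps_to_fls F"
  proof -
    have "fls_X_inv * (fps_to_fls F * fps_to_fls D) = of_nat q * x ^ k"
    proof -
      have "fls_X_inv * (of_nat q * fls_X * x ^ k) = (fls_X_inv * fls_X) * (of_nat q * x ^ k)"
        by (simp only: mult_ac)
      also have "fls_X_inv * fls_X = (1 :: complex fls)"
        by (metis fls_inverse_X fls_X_nonzero left_inverse)
      finally show ?thesis unfolding FD by simp
    qed
    then show ?thesis using D xq by (simp add: field_simps)
  qed
  with sum_runity_inverse[OF q k xq1]
  have "(\<Sum>z\<in>runity q. fls_const (inverse z ^ k) * inverse (fls_const z * x - 1)) = fls_X_inv * fps_to_fls F"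
    by simp
  moreover have "cth 1 z = inverse (fls_const z * x - 1) + fls_const (1 / 2)" for z
    by (simp add: cth_def x_def fls_times_fps_to_fls)
  ultimately have "(\<Sum>z\<in>runity q. fls_const (inverse z ^ k) * cth 1 z) =
    fls_X_inv * fps_to_fls F + fls_const ((\<Sum>z\<in>runity q. inverse z ^ k) * (1 / 2))"
    by (simp only: distrib_left sum.distrib fls_const_mult_const sum_distrib_right fls_const_sum)
  then have "fls_nth (\<Sum>z\<in>runity q. fls_const (inverse z ^ k) * cth 1 z) (int r - 1) =
    fls_nth (fls_X_inv * fps_to_fls F + fls_const ((\<Sum>z\<in>runity q. inverse z ^ k) * (1 / 2))) (int r - 1)"
    by simp
  moreover have "fls_nth (\<Sum>z\<in>runity q. fls_const (inverse z ^ k) * cth 1 z) (int r - 1) =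
      (\<Sum>z\<in>runity q. bern r z * inverse z ^ k)"
    by (simp add: fls_nth_sum bern_def mult.commute)
  moreover have "(\<Sum>z\<in>runity q. inverse z ^ k) = (if k = 0 then of_nat q else 0)"
    using sum_runity_character[OF q k q] by simp
  moreover have "fps_nth F r = of_nat q ^ r * bernpoly r t / fact r"
    by (simp add: F_def L_def fps_compose_linear)
  \<comment> \<open>The extra term q / 2 stems from the constant 1 / 2 in \<open>cth\<close>; it
    changes B_1 = -1 / 2 into the value 0 prescribed for the periodic function at integers.\<close>
  ultimately have main: "(\<Sum>z\<in>runity q. bern r z * inverse z ^ k) =
    of_nat q ^ r / fact r * bernpoly r t + (if r = 1 \<and> k = 0 then of_nat q / 2 else 0)"
    using r by (auto simp: fls_X_inv_times_conv_shift)
  have "t = of_real (of_nat k / of_nat q)" by (simp add: t_def)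
  then have bt: "bernpoly r t = of_real (bernpoly r (of_nat k / of_nat q))"
    using bernpoly_hom[of "of_real :: real \<Rightarrow> complex" r "of_nat k / of_nat q"] by simp
  show ?thesis
  proof (cases "k = 0")
    case True
    have "bernpoly 1 (0 :: real) = - 1 / 2" using bernoulli_0_1(2)[where 'a = real] by (simp add: bernoulli_def)
    then show ?thesis using True unfolding main bt pbernpoly_def
      by (auto simp: bernoulli_def simp del: One_nat_def)
  next
    case False
    have "of_nat k / of_nat q < (1 :: real)" "of_nat k / of_nat q > (0 :: real)" using False k by auto
    then have "frac (of_nat k / of_nat q :: real) = of_nat k / of_nat q" "of_nat k / of_nat q \<notin> (\<int> :: real set)"
      by (auto simp: frac_eq elim!: Ints_cases)
    then show ?thesis using False unfolding main bt pbernpoly_def by simp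
  qed
qed

lemma pbernpoly_mod:
  assumes "q > 0"
  shows "pbernpoly r (of_int (a mod q) / of_int q) = pbernpoly r (of_int a / of_int q)"
proof -
  have "of_int a = of_int (a div q) * of_int q + (of_int (a mod q) :: real)"
    by (metis div_mult_mod_eq of_int_add of_int_mult)
  then have eq: "(of_int a / of_int q :: real) = of_int (a mod q) / of_int q + of_int (a div q)"
    using assms by (simp add: field_simps)
  have "frac (x + of_int b) = frac x" for x :: real and b by (simp add: frac_def)
  moreover have "x + of_int b \<in> \<int> \<longleftrightarrow> x \<in> \<int>" for x :: real and b
    by (metis Ints_add Ints_diff Ints_of_int add_diff_cancel_right')
  ultimately show ?thesis unfolding eq pbernpoly_def by simp
qed

lemma sum_runity_bern_int:
  assumes q: "q > 0" and r: "r \<ge> 1"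
  shows "(\<Sum>z\<in>runity q. bern r z * inverse z powi k) = 
    of_nat q ^ r / fact r * of_real (pbernpoly r (of_int k / of_nat q))"
proof -
  define l where "l = nat (k mod int q)"
  have l: "l < q" "int l = k mod int q" using q by (simp_all add: l_def nat_less_iff)
  have "inverse z powi k = inverse z ^ l" if "z \<in> runity q" for z
  proof -
    have z: "z \<noteq> 0" using that q by (auto simp: power_0_left)
    have "inverse z powi k = inverse z powi (int q * (k div int q) + int l)" using l by simp
    also have "\<dots> = (inverse z ^ q) powi (k div int q) * inverse z ^ l"
      using z by (simp add: power_int_add power_int_mult)
    finally show ?thesis using that by (simp add: power_inverse)
  qed
  then have "(\<Sum>z\<in>runity q. bern r z * inverse z powi k) = (\<Sum>z\<in>runity q. bern r z * inverse z ^ l)"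
    by (intro sum.cong) auto
  also have "\<dots> = of_nat q ^ r / fact r * of_real (pbernpoly r (of_int (k mod int q) / of_int (int q)))"
    using sum_runity_bern[OF q r l(1)] l(2) by (metis of_int_of_nat_eq)
  finally show ?thesis using pbernpoly_mod[of "int q" r k] q by simp
qed

section \<open>Fourier inversion and the Dedekind sum\<close>

lemma sum_power_runity_elem:
  fixes y :: complex
  assumes q: "q > 0" and y: "y ^ q = 1"
  shows "(\<Sum>k\<in>{0..<int q}. y powi k) = (if y = 1 then of_nat q else 0)"
proof -
  have "(\<Sum>k\<in>{0..<int q}. y powi k) = (\<Sum>k<q. y ^ k)"
    by (rule sum.reindex_bij_witness[of _ int nat]) (auto simp: power_int_def)
  also have "\<dots> = (if y = 1 then of_nat q else 0)"
    using geometric_sum[of y q] y by simp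
  finally show ?thesis .
qed

text \<open>Fourier inversion on Z / q Z: summing over k first leaves only z = v, by
  orthogonality.\<close>

lemma convolution_bern:
  assumes q: "q > 0" and v: "v ^ q = 1"
  shows "(\<Sum>k\<in>{0..<int q}. (\<Sum>z\<in>runity q. bern r z * inverse z powi k) * v powi k) = of_nat q * bern r v"
proof -
  have "(\<Sum>k\<in>{0..<int q}. (\<Sum>z\<in>runity q. bern r z * inverse z powi k) * v powi k) =
    (\<Sum>z\<in>runity q. bern r z * (\<Sum>k\<in>{0..<int q}. (inverse z * v) powi k))"
    unfolding sum_distrib_right sum_distrib_left
    by (subst sum.swap) (simp add: power_int_mult_distrib mult.assoc)
  also have "\<dots> = (\<Sum>z\<in>runity q. if z = v then of_nat q * bern r v else 0)"
  proof (intro sum.cong refl)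
    fix z assume z: "z \<in> runity q"
    then have "z \<noteq> 0" using q by (auto simp: power_0_left)
    then have "inverse z * v = 1 \<longleftrightarrow> z = v" by (auto simp: field_simps)
    then show "bern r z * (\<Sum>k\<in>{0..<int q}. (inverse z * v) powi k) = (if z = v then of_nat q * bern r v else 0)"
      using z v q by (subst sum_power_runity_elem) (auto simp: power_mult_distrib power_inverse)
  qed
  finally show ?thesis using v q by (simp add: finite_runity)
qed

text \<open>The last periodic factor is expanded over roots of unity \<open>w\<close>; then the sum
  over tuples factorizes and each k_i is summed by Fourier inversion. The transforms contribute q^N
  and the n - 1 inversions q^(n-1), whence the exponent N - n + 1.\<close>

lemma dedekind_sum_eq_bern_sum:
  assumes n: "n \<ge> 2" and r: "\<forall>i\<in>{1..n}. r i \<ge> 1" and q: "q > 0"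
    and p: "\<forall>i\<in>{1..<n}. p i = int (P i)" and Pn: "P n = q - 1"
  shows "of_nat q ^ (sum r {1..n} - n + 1) / (\<Prod>i\<in>{1..n}. fact (r i)) * of_real (dedekind_sum n r (int q) p) =
    bern_sum q {1..n} r P"
proof -
  let ?I = "{1..<n}" and ?b = "\<lambda>i k. complex_of_real (pbernpoly (r i) (of_int k / of_int (int q)))"
  define f where "f i k = (\<Sum>z\<in>runity q. bern (r i) z * inverse z powi k)" for i k
  have f: "f i k = of_nat q ^ r i / fact (r i) * ?b i k" if "i \<in> {1..n}" for i k
    using sum_runity_bern_int[OF q, of "r i" k] r that by (simp add: f_def)
  have ins: "{1..n} = insert n ?I" using n by auto
  define c where "c = (\<Prod>i\<in>{1..n}. of_nat q ^ r i / fact (r i) :: complex)"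
  have "c * of_real (dedekind_sum n r (int q) p) =
     (\<Sum>k\<in>?I \<rightarrow>\<^sub>E {0..<int q}. (\<Prod>i\<in>?I. f i (k i)) * f n (\<Sum>i\<in>?I. p i * k i))"
    unfolding dedekind_sum_def of_real_sum sum_distrib_left
  proof (intro sum.cong refl)
    fix k
    have "(\<Prod>i\<in>?I. f i (k i)) = (\<Prod>i\<in>?I. of_nat q ^ r i / fact (r i)) * (\<Prod>i\<in>?I. ?b i (k i))"
      unfolding prod.distrib[symmetric] by (intro prod.cong refl f) auto
    then show "c * of_real ((\<Prod>i\<in>?I. pbernpoly (r i) (of_int (k i) / of_int (int q))) *
        pbernpoly (r n) (of_int (\<Sum>i\<in>?I. p i * k i) / of_int (int q))) =
      (\<Prod>i\<in>?I. f i (k i)) * f n (\<Sum>i\<in>?I. p i * k i)"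
      using f[of n "\<Sum>i\<in>?I. p i * k i"] n unfolding c_def ins by simp
  qed
  also have "\<dots> = (\<Sum>k\<in>?I \<rightarrow>\<^sub>E {0..<int q}. \<Sum>w\<in>runity q. bern (r n) w *
      (\<Prod>i\<in>?I. f i (k i) * (inverse w powi p i) powi k i))"
  proof (intro sum.cong refl)
    fix k
    have "inverse w powi (\<Sum>i\<in>J. p i * k i) = (\<Prod>i\<in>J. (inverse w powi p i) powi k i)"
      if "w \<in> runity q" "finite J" for w :: complex and J
    proof -
      have w0: "w \<noteq> 0" using that q by (auto simp: power_0_left)
      show ?thesis using that(2)
        by (induction J rule: finite_induct) (simp_all add: w0 power_int_add power_int_mult)
    qed
    then have w: "inverse w powi (\<Sum>i\<in>?I. p i * k i) = (\<Prod>i\<in>?I. (inverse w powi p i) powi k i)"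
      if "w \<in> runity q" for w :: complex
      using that by blast
    show "(\<Prod>i\<in>?I. f i (k i)) * f n (\<Sum>i\<in>?I. p i * k i) =
      (\<Sum>w\<in>runity q. bern (r n) w * (\<Prod>i\<in>?I. f i (k i) * (inverse w powi p i) powi k i))"
      unfolding f_def[of n] sum_distrib_left
      by (intro sum.cong refl) (simp only: w prod.distrib, simp only: mult_ac)
  qed
  also have "\<dots> = (\<Sum>w\<in>runity q. bern (r n) w *
      (\<Sum>k\<in>?I \<rightarrow>\<^sub>E {0..<int q}. \<Prod>i\<in>?I. f i (k i) * (inverse w powi p i) powi k i))"
    by (subst sum.swap) (simp only: sum_distrib_left)
  also have "\<dots> = (\<Sum>w\<in>runity q. bern (r n) w * (\<Prod>i\<in>?I. of_nat q * bern (r i) (inverse w powi p i)))"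
  proof (intro sum.cong refl arg_cong2[of _ _ _ _ "(*)"])
    fix w assume w: "w \<in> runity q"
    have "(\<Sum>k\<in>?I \<rightarrow>\<^sub>E {0..<int q}. \<Prod>i\<in>?I. f i (k i) * (inverse w powi p i) powi k i) =
      (\<Prod>i\<in>?I. \<Sum>k\<in>{0..<int q}. f i k * (inverse w powi p i) powi k)"
      by (rule prod_sum_PiE[symmetric]) auto
    also have "\<dots> = (\<Prod>i\<in>?I. of_nat q * bern (r i) (inverse w powi p i))"
    proof (intro prod.cong refl)
      fix i assume "i \<in> ?I"
      then have 1: "inverse w powi p i = inverse w ^ P i" using p by simp
      have "(inverse w ^ P i) ^ q = (inverse w ^ q) ^ P i" by (simp only: power_mult[symmetric] mult.commute)
      also have "\<dots> = 1" using w by (simp add: power_inverse)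
      finally have 2: "(inverse w ^ P i) ^ q = 1" .
      show "(\<Sum>k\<in>{0..<int q}. f i k * (inverse w powi p i) powi k) = of_nat q * bern (r i) (inverse w powi p i)"
        unfolding f_def 1 by (rule convolution_bern[OF q 2])
    qed
    finally show "(\<Sum>k\<in>?I \<rightarrow>\<^sub>E {0..<int q}. \<Prod>i\<in>?I. f i (k i) * (inverse w powi p i) powi k i) = \<dots>" .
  qed
  also have "\<dots> = (\<Sum>w\<in>runity q. bern (r n) (w ^ P n) * (\<Prod>i\<in>?I. of_nat q * bern (r i) (w ^ P i)))"
  \<comment> \<open>Replacing \<open>w\<close> by its inverse makes the exponents p_i positive and
    turns the last exponent 1 into -1, represented by q - 1.\<close>
  proof (rule sum.reindex_bij_witness[of _ inverse inverse])
    fix w assume w: "w \<in> runity q"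
    have "inverse w * inverse w ^ (q - 1) = inverse w ^ Suc (q - 1)" by (rule power_Suc[symmetric])
    also have "\<dots> = 1" using w q by (simp add: power_inverse)
    finally have "inverse (inverse w) = inverse w ^ (q - 1)" by (rule inverse_unique)
    then have "inverse w ^ P n = w" by (simp add: Pn)
    moreover have "inverse w powi p i = inverse w ^ P i" if "i \<in> ?I" for i using that p by simp
    ultimately show "bern (r n) (inverse w ^ P n) * (\<Prod>i\<in>?I. of_nat q * bern (r i) (inverse w ^ P i)) =
      bern (r n) w * (\<Prod>i\<in>?I. of_nat q * bern (r i) (inverse w powi p i))" by simp
  qed (auto simp: power_inverse)
  also have "\<dots> = of_nat q ^ (n - 1) * bern_sum q {1..n} r P"
    unfolding bern_sum_def ins by (simp add: prod.distrib sum_distrib_left mult_ac)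
  finally have eq: "c * of_real (dedekind_sum n r (int q) p) = of_nat q ^ (n - 1) * bern_sum q {1..n} r P" .
  \<comment> \<open>All r_i are positive, so N \<ge> n and the subtraction of naturals is not
    truncated.\<close>
  have "n = (\<Sum>i\<in>{1..n}. 1)" by simp
  also have "\<dots> \<le> sum r {1..n}" using r by (intro sum_mono) auto
  finally have "sum r {1..n} = (n - 1) + (sum r {1..n} - n + 1)" using n by simp
  then have "(of_nat q :: complex) ^ sum r {1..n} = of_nat q ^ (n - 1) * of_nat q ^ (sum r {1..n} - n + 1)"
    by (metis power_add)
  then have "c = of_nat q ^ (n - 1) * of_nat q ^ (sum r {1..n} - n + 1) / (\<Prod>i\<in>{1..n}. fact (r i))"
    by (simp only: c_def prod_dividef power_sum[symmetric])
  with eq show ?thesis using q by (simp add: mult.assoc flip: times_divide_eq_right)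
qed

subsection \<open>The congruence\<close>

lemma weak_compositions_eq_comps: "weak_compositions N n = comps {1..n} N"
  by (simp add: weak_compositions_def comps_def)

text \<open>The indices are renumbered from 1 and the tuple is padded with zeros to length
  \<open>n\<close>, which gives a monomial of the Todd polynomial.\<close>

lemma clears_todd_todd_denom: "clears_todd (todd_denom N n) N n"
  unfolding clears_todd_def
proof (intro allI impI)
  fix A :: "nat set" and m :: "nat \<Rightarrow> nat"
  assume A: "finite A" "card A \<le> n" "sum m A = N"
  obtain f where f: "bij_betw f {1..card A} A"
    using ex_bij_betw_nat_finite_1[OF A(1)] by blast
  define m' where "m' = restrict (\<lambda>i. if i \<le> card A then m (f i) else 0) {1..n}"
  have sub: "{1..card A} \<subseteq> {1..n}" using A by auto
  have "sum m' {1..n} = sum m' {1..card A}"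
    by (rule sum.mono_neutral_right) (use sub in \<open>auto simp: m'_def\<close>)
  also have "\<dots> = (\<Sum>i\<in>{1..card A}. m (f i))" by (intro sum.cong) (use sub in \<open>auto simp: m'_def\<close>)
  also have "\<dots> = N" using sum.reindex_bij_betw[OF f, of m] A by simp
  finally have "m' \<in> weak_compositions N n"
    unfolding weak_compositions_eq_comps by (intro compsI) (auto simp: m'_def)
  from todd_denom_integral[OF this] obtain c :: int where
    c: "of_int (todd_denom N n) * (\<Prod>i\<in>{1..n}. bernoulli (m' i) / fact (m' i)) = (of_int c :: rat)"
    by (auto elim: Ints_cases)
  have "(\<Prod>i\<in>{1..n}. bernoulli (m' i) / fact (m' i) :: complex) = (\<Prod>i\<in>{1..card A}. bernoulli (m' i) / fact (m' i))"
    by (rule prod.mono_neutral_right) (use sub in \<open>auto simp: m'_def bernoulli_0_1\<close>)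
  also have "\<dots> = (\<Prod>i\<in>{1..card A}. bernoulli (m (f i)) / fact (m (f i)))"
    by (intro prod.cong) (use sub in \<open>auto simp: m'_def\<close>)
  also have "\<dots> = (\<Prod>j\<in>A. bernoulli (m j) / fact (m j))"
    using prod.reindex_bij_betw[OF f, of "\<lambda>j. bernoulli (m j) / fact (m j) :: complex"] by simp
  finally have eq: "(\<Prod>j\<in>A. bernoulli (m j) / fact (m j)) =
     (\<Prod>i\<in>{1..n}. bernoulli (m' i) / fact (m' i) :: complex)" ..
  have "of_int (todd_denom N n) * (\<Prod>j\<in>A. bernoulli (m j) / fact (m j) :: complex) =
    of_rat (of_int (todd_denom N n) * (\<Prod>i\<in>{1..n}. bernoulli (m' i) / fact (m' i)))"
  proof -
    have 1: "of_rat (\<Prod>i\<in>I. g i) = (\<Prod>i\<in>I. of_rat (g i) :: complex)" for g and I :: "nat set"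
      by (induction I rule: infinite_finite_induct) (simp_all add: of_rat_mult)
    have 2: "of_rat (fact k) = (fact k :: complex)" for k
      by (metis of_nat_fact of_rat_of_nat_eq)
    show ?thesis unfolding eq by (simp add: of_rat_mult of_rat_divide 1 2 bernoulli_of_rat)
  qed
  also have "\<dots> = of_int c" by (simp only: c) simp
  finally show "of_int (todd_denom N n) * (\<Prod>j\<in>A. bernoulli (m j) / fact (m j)) \<in> (\<int> :: complex set)" by simp
qed

text \<open>Oddness at the fixed point u = 1 of inversion. This is why only even tuples remain in
  the congruence.\<close>

lemma bern_at_1_parity: "bern m 1 = (if even m then bernoulli m / fact m else 0)"
proof (cases "even m")
  case False
  then show ?thesis using bern_inverse[of 1 m] by (cases "m = 0") (auto simp: odd_pos)
next
  case True
  then show ?thesis by (auto simp: bern_at_1)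
qed

lemma bern_sum_1: "bern_sum 1 A m p = (\<Prod>j\<in>A. bern (m j) 1)"
  by (simp add: bern_sum_def)

text \<open>Membership of x / q in \<open>loc_int l\<close> expresses that x vanishes modulo the
  \<open>l\<close>-part of \<open>q\<close>. In reciprocity for order \<open>q\<close>, terms with
  \<open>m 0\<close> = 0 have order dividing both \<open>q\<close> and some \<open>P i\<close>, so
  order 1, and form the even sum; all others carry a factor \<open>q\<close>, with an
  \<open>l\<close>-integral cofactor after multiplication by \<open>d\<close>.\<close>

lemma bern_sum_cong_mod:
  assumes d: "clears_todd d N n" and N: "N = sum r {1..n}" and n: "n \<ge> 1"
    and r: "\<And>i. i \<in> {1..n} \<Longrightarrow> r i \<ge> 1" and P: "\<And>i. i \<in> {1..n} \<Longrightarrow> P i > 0 \<and> coprime (P i) q"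
    and q: "q > 0" and l: "prime l" "l dvd q"
  shows "(of_int d * bern_sum q {1..n} r P + of_int d * (\<Sum>m\<in>even_compositions_with_zero N n.
      \<Prod>i\<in>{1..n}. bernoulli (m i) / fact (m i) * rcoef (r i) (P i) (m i))) / of_nat q \<in> loc_int l"
proof -
  \<comment> \<open>The index 0 lies outside {1..n} and plays the part of the adjoined index of
    order \<open>q\<close>.\<close>
  let ?A = "{1..n}"
  define B where "B = insert 0 ?A"
  define p2 where "p2 = P(0 := q)"
  define T where "T = {m\<in>comps B N. \<exists>j\<in>?A. m j = 0}"
  define E :: complex where "E = (if \<forall>j\<in>?A. r j = 1 then (1 / 2) ^ Suc (card ?A) - (-1 / 2) ^ Suc (card ?A) else 0)"
  define S where "S m = bern_sum (Gcd (p2 ` {j\<in>B. m j = 0})) {j\<in>B. m j \<noteq> 0} m p2" for m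
  define R where "R m = (\<Prod>j\<in>?A. rcoef (r j) (P j) (m j))" for m
  have finT: "finite T" unfolding T_def by (simp add: finite_comps B_def)
  have lP: "\<not> l dvd P j" if "j \<in> ?A" for j
    using P[OF that] l by (metis coprime_common_divisor_nat not_prime_1 nat_dvd_1_iff_1)
  have pre: "r j \<ge> 1 \<and> P j > 0" if "j \<in> ?A" for j using r P that by auto
  have "bern_sum q ?A r P = of_nat q * E - (\<Sum>m\<in>T. of_nat q ^ m 0 * R m * S m)"
    using bern_sum_reciprocity[of ?A 0 r P q, OF _ _ pre q] unfolding E_def T_def R_def S_def B_def p2_def N
    by simp
  also have "(\<Sum>m\<in>T. of_nat q ^ m 0 * R m * S m) =
      (\<Sum>m\<in>{m\<in>T. m 0 = 0}. R m * S m) + (\<Sum>m\<in>{m\<in>T. m 0 \<noteq> 0}. of_nat q ^ m 0 * R m * S m)"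
  proof -
    have "T = {m\<in>T. m 0 = 0} \<union> {m\<in>T. m 0 \<noteq> 0}" by auto
    then have "(\<Sum>m\<in>T. of_nat q ^ m 0 * R m * S m) =
      (\<Sum>m\<in>{m\<in>T. m 0 = 0}. of_nat q ^ m 0 * R m * S m) + (\<Sum>m\<in>{m\<in>T. m 0 \<noteq> 0}. of_nat q ^ m 0 * R m * S m)"
      using finT by (subst sum.union_disjoint[symmetric]) auto
    then show ?thesis by simp
  qed
  also have "(\<Sum>m\<in>{m\<in>T. m 0 = 0}. R m * S m) = (\<Sum>m\<in>{m\<in>comps ?A N. \<exists>j\<in>?A. m j = 0}.
      \<Prod>i\<in>?A. bern (m i) 1 * rcoef (r i) (P i) (m i))"
  proof (rule sum.reindex_bij_witness[of _ "\<lambda>m. m(0 := 0)" "\<lambda>m. restrict m ?A"])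
    fix m assume m: "m \<in> {m\<in>T. m 0 = 0}"
    then have ext: "m \<in> extensional B" and sm: "sum m ?A = N" and z: "\<exists>j\<in>?A. m j = 0" and m0: "m 0 = 0"
      by (auto simp: T_def comps_def B_def PiE_def)
    show "(restrict m ?A)(0 := 0) = m"
      using ext m0 by (auto simp: fun_eq_iff extensional_def B_def restrict_def)
    have "sum (restrict m ?A) ?A = N" using sm by simp
    then show "restrict m ?A \<in> {m\<in>comps ?A N. \<exists>j\<in>?A. m j = 0}"
      using z by (auto intro!: compsI)
    obtain i where i: "i \<in> ?A" "m i = 0" using z by blast
    let ?g = "Gcd (p2 ` {j\<in>B. m j = 0})"
    have "?g dvd p2 0" "?g dvd p2 i" using i m0 by (auto simp: B_def)
    then have "?g dvd q" "?g dvd P i" using i(1) by (auto simp: p2_def)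
    then have g: "?g = 1" using P[OF i(1)] by (metis coprime_common_divisor_nat)
    have "S m = (\<Prod>j\<in>{j\<in>B. m j \<noteq> 0}. bern (m j) 1)" unfolding S_def g by (rule bern_sum_1)
    also have "{j\<in>B. m j \<noteq> 0} = {j\<in>?A. m j \<noteq> 0}" using m0 by (auto simp: B_def)
    also have "(\<Prod>j\<in>{j\<in>?A. m j \<noteq> 0}. bern (m j) 1) = (\<Prod>j\<in>?A. bern (m j) 1)"
      by (rule prod.mono_neutral_left) (auto simp: bern_at_1_parity bernoulli_0_1)
    finally have "R m * S m = (\<Prod>i\<in>?A. bern (m i) 1 * rcoef (r i) (P i) (m i))"
      by (simp add: R_def prod.distrib mult.commute)
    then show "(\<Prod>i\<in>?A. bern (restrict m ?A i) 1 * rcoef (r i) (P i) (restrict m ?A i)) = R m * S m" by simp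
  next
    fix m assume m: "m \<in> {m\<in>comps ?A N. \<exists>j\<in>?A. m j = 0}"
    then have ext: "m \<in> extensional ?A" and sm: "sum m ?A = N" and z: "\<exists>j\<in>?A. m j = 0"
      by (auto simp: comps_def PiE_def)
    show "restrict (m(0 := 0)) ?A = m" using ext by (auto simp: fun_eq_iff extensional_def)
    have "sum (m(0 := 0)) ?A = N" unfolding sm[symmetric] by (intro sum.cong) auto
    then have "m(0 := 0) \<in> comps B N" using ext
      by (intro compsI) (auto simp: B_def extensional_def)
    then show "m(0 := 0) \<in> {m\<in>T. m 0 = 0}" using z by (auto simp: T_def)
  qed
  also have "\<dots> = (\<Sum>m\<in>even_compositions_with_zero N n.
      \<Prod>i\<in>?A. bernoulli (m i) / fact (m i) * rcoef (r i) (P i) (m i))"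
  proof (rule sum.mono_neutral_cong_right)
    show "finite {m\<in>comps ?A N. \<exists>j\<in>?A. m j = 0}" by (simp add: finite_comps)
    show "even_compositions_with_zero N n \<subseteq> {m\<in>comps ?A N. \<exists>j\<in>?A. m j = 0}"
      by (auto simp: even_compositions_with_zero_def weak_compositions_eq_comps)
    show "\<forall>m\<in>{m\<in>comps ?A N. \<exists>j\<in>?A. m j = 0} - even_compositions_with_zero N n.
       (\<Prod>i\<in>?A. bern (m i) 1 * rcoef (r i) (P i) (m i)) = 0"
    proof
      fix m assume "m \<in> {m\<in>comps ?A N. \<exists>j\<in>?A. m j = 0} - even_compositions_with_zero N n"
      then obtain i where "i \<in> ?A" "odd (m i)"
        by (auto simp: even_compositions_with_zero_def weak_compositions_eq_comps)
      then show "(\<Prod>i\<in>?A. bern (m i) 1 * rcoef (r i) (P i) (m i)) = 0"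
        by (intro prod_zero) (auto intro!: bexI[of _ i] simp: bern_at_1_parity)
    qed
  qed (auto simp: even_compositions_with_zero_def bern_at_1_parity intro!: prod.cong)
  finally have S: "bern_sum q ?A r P + (\<Sum>m\<in>even_compositions_with_zero N n.
      \<Prod>i\<in>?A. bernoulli (m i) / fact (m i) * rcoef (r i) (P i) (m i)) =
    of_nat q * E - (\<Sum>m\<in>{m\<in>T. m 0 \<noteq> 0}. of_nat q ^ m 0 * R m * S m)" by simp
  have q_pow: "of_nat q ^ m / of_nat q = (of_nat q ^ (m - 1) :: complex)" if "m \<noteq> 0" for m
    using that q by (cases m) auto
  have "(of_int d * bern_sum q ?A r P + of_int d * (\<Sum>m\<in>even_compositions_with_zero N n.
      \<Prod>i\<in>?A. bernoulli (m i) / fact (m i) * rcoef (r i) (P i) (m i))) / of_nat q =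
    of_int d * (of_nat q * E - (\<Sum>m\<in>{m\<in>T. m 0 \<noteq> 0}. of_nat q ^ m 0 * R m * S m)) / of_nat q"
    unfolding S[symmetric] by (simp only: distrib_left)
  also have "\<dots> = of_int d * E - (\<Sum>m\<in>{m\<in>T. m 0 \<noteq> 0}. of_int d * (of_nat q ^ m 0 * R m * S m) / of_nat q)"
    using q by (simp add: right_diff_distrib diff_divide_distrib sum_distrib_left sum_divide_distrib)
  also have "(\<Sum>m\<in>{m\<in>T. m 0 \<noteq> 0}. of_int d * (of_nat q ^ m 0 * R m * S m) / of_nat q) =
    (\<Sum>m\<in>{m\<in>T. m 0 \<noteq> 0}. of_nat q ^ (m 0 - 1) * R m * (of_int d * S m))"
  proof (intro sum.cong refl)
    fix m assume "m \<in> {m\<in>T. m 0 \<noteq> 0}"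
    then have "of_nat q ^ m 0 / of_nat q = (of_nat q ^ (m 0 - 1) :: complex)" by (intro q_pow) simp
    then show "of_int d * (of_nat q ^ m 0 * R m * S m) / of_nat q =
        of_nat q ^ (m 0 - 1) * R m * (of_int d * S m)"
      by (metis (no_types, lifting) mult.assoc mult.commute times_divide_eq_left)
  qed
  also have "of_int d * E - \<dots> \<in> loc_int l"
  proof (rule loc_int_diff[OF l(1) _ loc_int_sum[OF l(1)]])
    have "of_int d * E \<in> \<int>"
    proof (cases "(\<forall>j\<in>?A. r j = 1) \<and> even n")
      case True
      then have N': "N = n" by (simp add: N)
      \<comment> \<open>Here N = n, so the constant tuple 1 has weight \<open>N\<close> and
        \<open>d\<close> clears its product.\<close>
      have "of_int d * (\<Prod>j\<in>?A. bernoulli 1 / fact 1) \<in> (\<int> :: complex set)"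
        using d[unfolded clears_todd_def, rule_format, of ?A "\<lambda>_. 1"] N' by simp
      moreover have "E = (\<Prod>j\<in>?A. bernoulli 1 / fact 1)"
        unfolding E_def half_power_diff using True by (simp add: bernoulli_0_1 del: One_nat_def)
      ultimately show ?thesis by simp
    next
      case False
      then have "E = 0" unfolding E_def half_power_diff by auto
      then show ?thesis by simp
    qed
    then show "of_int d * E \<in> loc_int l" by (rule loc_int_Ints[OF l(1)])
    fix m assume m: "m \<in> {m\<in>T. m 0 \<noteq> 0}"
    then obtain i where i: "i \<in> ?A" "m i = 0" by (auto simp: T_def)
    let ?g = "Gcd (p2 ` {j\<in>B. m j = 0})"
    have "?g dvd p2 i" using i by (auto simp: B_def)
    then have gi: "?g dvd P i" using i by (auto simp: p2_def)
    have "of_int d * S m \<in> loc_int l" unfolding S_def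
    proof (rule bern_sum_loc_int[OF l(1) d])
      show "?g > 0" using gi P[OF i(1)] dvd_pos_nat by blast
      show "\<not> l dvd ?g" using gi lP[OF i(1)] dvd_trans by blast
      \<comment> \<open>The zero at \<open>i\<close> makes room for the index 0, keeping the bound
        \<open>n\<close> on the number of factors.\<close>
      have "{j\<in>B. m j \<noteq> 0} \<subseteq> insert 0 (?A - {i})" using i by (auto simp: B_def)
      then have "card {j\<in>B. m j \<noteq> 0} \<le> card (insert 0 (?A - {i}))" by (intro card_mono) auto
      also have "\<dots> = n" using i n by (subst card_insert_disjoint) auto
      finally show "card {j\<in>B. m j \<noteq> 0} \<le> n" .
      have "sum m {j\<in>B. m j \<noteq> 0} = sum m B"
        by (rule sum.mono_neutral_left) (auto simp: B_def)
      also have "\<dots> = N" using m by (simp add: T_def comps_def)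
      finally show "sum m {j\<in>B. m j \<noteq> 0} = N" .
    qed (auto simp: B_def)
    moreover have "R m \<in> loc_int l" unfolding R_def
      by (intro loc_int_prod rcoef_loc_int l(1) lP)
    moreover have "of_nat q ^ (m 0 - 1) \<in> loc_int l" by (intro loc_int_Ints l(1)) auto
    ultimately show "of_nat q ^ (m 0 - 1) * R m * (of_int d * S m) \<in> loc_int l"
      using loc_int_mult[OF l(1)] by blast
  qed
  finally show ?thesis .
qed

section \<open>From local congruences to the theorem\<close>

lemma loc_int_diff_prod:
  fixes x y :: "'i \<Rightarrow> complex"
  assumes l: "prime l"
    and xy: "\<And>i. i \<in> I \<Longrightarrow> x i \<in> loc_int l \<and> y i \<in> loc_int l \<and> (x i - y i) / c \<in> loc_int l"
  shows "(prod x I - prod y I) / c \<in> loc_int l"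
  using xy
proof (induction I rule: infinite_finite_induct)
  case (insert i I)
  \<comment> \<open>Telescoping: one factor is exchanged at a time, as in the proof that congruences
    can be multiplied.\<close>
  have "(x i * prod x I - y i * prod y I) / c = (x i - y i) / c * prod x I + y i * ((prod x I - prod y I) / c)"
    by (cases "c = 0") (simp_all add: field_simps)
  moreover have "prod x I \<in> loc_int l" using insert.prems by (intro loc_int_prod l) auto
  moreover have "x i \<in> loc_int l \<and> y i \<in> loc_int l \<and> (x i - y i) / c \<in> loc_int l"
    using insert.prems by blast
  moreover have "(prod x I - prod y I) / c \<in> loc_int l" using insert.prems by (intro insert.IH) blast
  ultimately have "(x i * prod x I - y i * prod y I) / c \<in> loc_int l"
    using loc_int_add[OF l loc_int_mult[OF l] loc_int_mult[OF l]] by metis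
  then show ?case using insert.hyps by simp
qed (use loc_int_Ints[OF l, of 0] in auto)

text \<open>Reciprocity produces rational powers of \<open>P\<close>, the theorem integer
  representatives. For negative exponents the modular inverse \<open>u\<close> satisfies u P
  \<equiv> 1, and dividing by \<open>P\<close> is harmless at a prime \<open>l\<close> not dividing
  \<open>P\<close>.\<close>

lemma mod_powi_cong:
  assumes l: "prime l" "\<not> l dvd P" and q: "q > 0" and cop: "coprime a (int q)" and aP: "[a = int P] (mod int q)"
  shows "(of_int (mod_powi (int q) a e) - of_nat P powi e) / of_nat q \<in> loc_int l"
proof -
  have dvd: "of_int x / of_nat q \<in> loc_int l" if x: "int q dvd x" for x
  proof -
    obtain c where "x = int q * c" using x by (elim dvdE)
    then have "of_int x / of_nat q = (of_int c :: complex)" using q by simp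
    then show ?thesis using l by (auto intro: loc_int_Ints)
  qed
  have pw: "((of_int u :: complex) ^ k - v ^ k) / of_nat q \<in> loc_int l"
    if "(of_int u - v) / of_nat q \<in> loc_int l" "v \<in> loc_int l" for u v k
    using loc_int_diff_prod[OF l(1), of "{..<k}" "\<lambda>_. of_int u" "\<lambda>_. v" "of_nat q"] that
      loc_int_Ints[OF l(1) Ints_of_int, of u] by simp
  have P0: "P \<noteq> 0" using l by (intro notI) simp
  show ?thesis
  proof (cases "e \<ge> 0")
    case True
    have "int q dvd a - int P" using aP by (simp add: cong_iff_dvd_diff)
    from dvd[OF this] have "(of_int a - of_nat P) / of_nat q \<in> loc_int l" by simp
    from pw[OF this loc_int_Ints[OF l(1) Ints_of_nat], of "nat e"] show ?thesis using True
      by (simp add: mod_powi_def power_int_def)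
  next
    case False
    define u where "u = modular_inverse (int q) a"
    have "[u * int P = u * a] (mod int q)" using aP by (simp add: cong_sym cong_scalar_left)
    also have "[u * a = 1] (mod int q)" unfolding u_def using cop by (rule cong_modular_inverse2)
    finally have "int q dvd u * int P - 1" by (simp add: cong_iff_dvd_diff)
    from dvd[OF this] have 1: "(of_int u * of_nat P - 1) / of_nat q \<in> loc_int l" by simp
    have 2: "of_nat P powi (-1) \<in> loc_int l" using l by (rule loc_int_powi)
    have "(of_int u - of_nat P powi (-1)) / of_nat q = (of_int u * of_nat P - 1) / of_nat q * (of_nat P powi (-1) :: complex)"
      using P0 q by (simp add: field_simps power_int_minus)
    then have "(of_int u - of_nat P powi (-1)) / of_nat q \<in> loc_int l"
      by (simp only: loc_int_mult[OF l(1) 1 2])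
    from pw[OF this 2, of "nat (- e)"] show ?thesis using False
      by (simp add: mod_powi_def u_def power_int_def)
  qed
qed

theorem theorem5p4:
  fixes n N :: nat and r :: "nat \<Rightarrow> nat" and d :: int
  assumes "n \<ge> 2"
    and "\<forall>i\<in>{1..n}. r i \<ge> 1"
    and "N = (\<Sum>i\<in>{1..n}. r i)"
    and "d = todd_denom N n"
  shows "\<forall>(q, p) \<in> I_set n.
    \<exists>a b :: int.
      real_of_int a =
        of_int d * of_int q ^ (N - n + 1) / (\<Prod>i\<in>{1..n}. fact (r i)) * dedekind_sum n r q p \<and>
      real_of_int b =
        (\<Sum>m\<in>even_compositions_with_zero N n.
           - of_int d *
           (\<Prod>i\<in>{1..n}. bernoulli (m i) / fact (m i) * ((real (m i) - 1) gchoose (r i - 1)) *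
              of_int (mod_powi q ((p(n := -1)) i) (int (m i) - int (r i))))) \<and>
      [a = b] (mod q)"
proof (intro ballI, clarify)
  fix q' p assume "(q', p) \<in> I_set n"
  then have I: "q' > 0" "\<And>i. i \<in> {1..<n} \<Longrightarrow> 0 < p i \<and> p i < q' \<and> coprime (p i) q'"
    by (auto simp: I_set_def)
  define q where "q = nat q'"
  have q: "q' = int q" "q > 0" using I(1) by (simp_all add: q_def)
  \<comment> \<open>As n \<ge> 2, there is a p_1 with 0 < p_1 < q'. Hence q - 1 is positive and can
    represent p_n = -1.\<close>
  have "q' \<ge> 2" using I(2)[of 1] assms(1) by auto
  then have q2: "q \<ge> 2" using q by simp
  define P where "P i = (if i = n then q - 1 else nat (p i))" for i
  define a' where "a' = p(n := -1)"
  have P: "P i > 0 \<and> coprime (P i) q \<and> coprime (a' i) (int q) \<and> [a' i = int (P i)] (mod int q)"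
    if "i \<in> {1..n}" for i
  proof (cases "i = n")
    case True
    have "coprime (q - 1) q" using q2 by (metis coprime_diff_one_left_nat q(2))
    moreover have "[- 1 = int (q - 1)] (mod int q)" using q2
      by (simp add: of_nat_diff cong_iff_dvd_diff)
    ultimately show ?thesis using True q2 by (simp add: P_def a'_def)
  next
    case False
    then have "i \<in> {1..<n}" using that by auto
    from I(2)[OF this] have "0 < p i" "coprime (p i) (int q)" using q by auto
    then show ?thesis using False by (auto simp: P_def a'_def coprime_int_iff[symmetric])
  qed
  have r: "r i \<ge> 1" if "i \<in> {1..n}" for i using assms(2) that by auto
  have d: "clears_todd d N n" unfolding assms(4) by (rule clears_todd_todd_denom)
  define S where "S = of_int d * bern_sum q {1..n} r P"
  define M where "M = even_compositions_with_zero N n"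
  \<comment> \<open>The integral part of a summand. \<open>A\<close> completes it with rational
    powers of \<open>P i\<close>, \<open>B\<close> with integer representatives modulo
    \<open>q'\<close>; the right side of the theorem is -\<open>B\<close>.\<close>
  define D where "D m = of_int d * (\<Prod>i\<in>{1..n}. bernoulli (m i) / fact (m i)) * 
    (\<Prod>i\<in>{1..n}. (of_nat (m i) - 1) gchoose (r i - 1) :: complex)" for m
  define A where "A = (\<Sum>m\<in>M. D m * (\<Prod>i\<in>{1..n}. of_nat (P i) powi (int (m i) - int (r i))))"
  define B where "B = (\<Sum>m\<in>M. D m * (\<Prod>i\<in>{1..n}. of_int (mod_powi q' (a' i) (int (m i) - int (r i)))))"
  have A: "A = of_int d * (\<Sum>m\<in>M. \<Prod>i\<in>{1..n}. bernoulli (m i) / fact (m i) * rcoef (r i) (P i) (m i))"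
    unfolding A_def D_def rcoef_def sum_distrib_left prod.distrib by (simp only: mult_ac)
  have DZ: "D m \<in> \<int>" if "m \<in> M" for m
  proof -
    have "sum m {1..n} = N" using that by (simp add: M_def even_compositions_with_zero_def weak_compositions_def)
    then have "of_int d * (\<Prod>i\<in>{1..n}. bernoulli (m i) / fact (m i)) \<in> (\<int> :: complex set)"
      using d[unfolded clears_todd_def, rule_format, of "{1..n}" m] by simp
    then show ?thesis unfolding D_def by (rule Ints_mult) (intro Ints_prod gbinomial_pred_Ints)
  qed
  have "B \<in> \<int>" unfolding B_def using DZ by (intro Ints_sum Ints_mult Ints_prod) auto
  then obtain b where b: "- B = of_int b" by (metis Ints_cases Ints_minus)
  have lP: "\<not> l dvd P i" if "i \<in> {1..n}" "prime l" "l dvd q" for l i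
    using P[OF that(1)] that by (metis coprime_common_divisor_nat not_prime_1 nat_dvd_1_iff_1)
  have main: "(S + A) / of_nat q \<in> loc_int l" if "prime l" "l dvd q" for l
    unfolding S_def A M_def
    by (rule bern_sum_cong_mod[OF d assms(3) _ r _ q(2) that]) (use assms(1) P in auto)
  have AB: "(B - A) / of_nat q \<in> loc_int l" if l: "prime l" "l dvd q" for l
  proof -
    have "(B - A) / of_nat q = (\<Sum>m\<in>M. D m *
      (((\<Prod>i\<in>{1..n}. of_int (mod_powi q' (a' i) (int (m i) - int (r i)))) -
        (\<Prod>i\<in>{1..n}. of_nat (P i) powi (int (m i) - int (r i)))) / of_nat q))"
      unfolding A_def B_def sum_subtractf[symmetric] sum_divide_distrib
      by (intro sum.cong refl) (simp add: right_diff_distrib)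
    also have "\<dots> \<in> loc_int l"
    proof (intro loc_int_sum loc_int_mult l(1) loc_int_diff_prod)
      show "D m \<in> loc_int l" if "m \<in> M" for m using DZ[OF that] l by (intro loc_int_Ints)
      fix m i assume i: "i \<in> {1..n}"
      have "of_int (mod_powi q' (a' i) (int (m i) - int (r i))) \<in> loc_int l"
        using l by (intro loc_int_Ints) auto
      moreover have "of_nat (P i) powi (int (m i) - int (r i)) \<in> loc_int l"
        using l lP[OF i l] by (intro loc_int_powi)
      moreover have "(of_int (mod_powi q' (a' i) (int (m i) - int (r i))) - of_nat (P i) powi (int (m i) - int (r i)))
          / of_nat q \<in> loc_int l"
        unfolding q(1) using P[OF i] by (intro mod_powi_cong l(1) lP[OF i l] q(2)) auto
      ultimately show "of_int (mod_powi q' (a' i) (int (m i) - int (r i))) \<in> loc_int l \<and>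
        of_nat (P i) powi (int (m i) - int (r i)) \<in> loc_int l \<and>
        (of_int (mod_powi q' (a' i) (int (m i) - int (r i))) - of_nat (P i) powi (int (m i) - int (r i)))
          / of_nat q \<in> loc_int l" by blast
    qed
    finally show ?thesis .
  qed
  have SB: "(S + B) / of_nat q \<in> loc_int l" if l: "prime l" "l dvd q" for l
  proof -
    have "(S + B) / of_nat q = (S + A) / of_nat q + (B - A) / of_nat q"
      by (simp flip: add_divide_distrib)
    then show ?thesis using loc_int_add[OF l(1) main[OF l] AB[OF l]] by simp
  qed
  \<comment> \<open>At primes dividing \<open>q\<close> integrality follows from the congruence
    itself, since \<open>B\<close> is an integer; at the others the induction on the order applies
    directly.\<close>
  have "S \<in> loc_int l" if l: "prime l" for l
  proof (cases "l dvd q")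
    case True
    have "S = of_nat q * ((S + B) / of_nat q) - B" using q by simp
    moreover have "\<dots> \<in> loc_int l" using SB[OF l True] \<open>B \<in> \<int>\<close> l
      by (intro loc_int_diff loc_int_mult) (auto intro: loc_int_Ints)
    ultimately show ?thesis by simp
  next
    case False
    then show ?thesis unfolding S_def using r assms(3) q(2)
      by (intro bern_sum_loc_int[OF l d]) (auto simp: Suc_le_eq)
  qed
  then have "S \<in> \<int>" by (rule Ints_if_loc_int)
  then obtain a where a: "S = of_int a" by (auto elim: Ints_cases)
  have "(S + B) / of_nat q \<in> \<int>"
  proof (rule Ints_if_loc_int)
    fix l :: nat assume l: "prime l"
    show "(S + B) / of_nat q \<in> loc_int l"
    proof (cases "l dvd q")
      case False
      \<comment> \<open>When \<open>l\<close> does not divide \<open>q\<close>, the inverse of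
        \<open>q\<close> is \<open>l\<close>-integral and the congruence is void at
        \<open>l\<close>.\<close>
      have "(S + B) / of_nat q = (S + B) * of_nat q powi (-1)" by (simp add: power_int_minus divide_inverse)
      moreover have "\<dots> \<in> loc_int l" using \<open>S \<in> \<int>\<close> \<open>B \<in> \<int>\<close> l False
        by (intro loc_int_mult loc_int_powi) (auto intro: loc_int_Ints)
      ultimately show ?thesis by simp
    qed (rule SB[OF l])
  qed
  then obtain c where c: "(S + B) / of_nat q = of_int c" by (auto elim: Ints_cases)
  have "B = - of_int b" using b by (metis minus_minus)
  then have "of_int (a - b) = S + B" using a by simp
  also have "\<dots> = of_int (c * int q)" using c q(2) by (simp add: field_simps)
  finally have "a - b = c * int q" by (simp only: of_int_eq_iff)
  then have cong: "[a = b] (mod q')" by (simp add: cong_iff_dvd_diff q)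
  \<comment> \<open>The equations were obtained over the complex numbers; injectivity of
    \<open>of_real\<close> brings them back to the reals.\<close>
  have "complex_of_real (of_int a) = of_real
      (of_int d * of_int q' ^ (N - n + 1) / (\<Prod>i\<in>{1..n}. fact (r i)) * dedekind_sum n r q' p)"
  proof -
    have "of_nat q ^ (N - n + 1) / (\<Prod>i\<in>{1..n}. fact (r i)) * of_real (dedekind_sum n r (int q) p) =
        bern_sum q {1..n} r P"
      unfolding assms(3) by (rule dedekind_sum_eq_bern_sum[OF assms(1,2) q(2)])
        (use I(2) in \<open>auto simp: P_def less_imp_le\<close>)
    then have "of_int a = of_int d * (of_nat q ^ (N - n + 1) / (\<Prod>i\<in>{1..n}. fact (r i)) * complex_of_real (dedekind_sum n r (int q) p))"
      using a S_def by simp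
    then show ?thesis by (simp add: q)
  qed
  then have a_eq: "real_of_int a =
        of_int d * of_int q' ^ (N - n + 1) / (\<Prod>i\<in>{1..n}. fact (r i)) * dedekind_sum n r q' p"
    by (simp only: of_real_eq_iff)
  have "complex_of_real (of_int b) = of_real (\<Sum>m\<in>M. - of_int d *
      (\<Prod>i\<in>{1..n}. bernoulli (m i) / fact (m i) * ((real (m i) - 1) gchoose (r i - 1)) *
         of_int (mod_powi q' (a' i) (int (m i) - int (r i)))))"
  proof -
    have gb: "of_real ((real k - 1) gchoose j) = ((of_nat k - 1) gchoose j :: complex)" for k j
      by (simp add: gbinomial_prod_rev)
    show ?thesis unfolding of_real_sum
      by (simp add: b[symmetric] B_def D_def sum_negf[symmetric] prod.distrib gb bernoulli_of_real mult_ac prod_dividef)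
  qed
  then have b_eq: "real_of_int b = (\<Sum>m\<in>M. - of_int d *
      (\<Prod>i\<in>{1..n}. bernoulli (m i) / fact (m i) * ((real (m i) - 1) gchoose (r i - 1)) *
         of_int (mod_powi q' (a' i) (int (m i) - int (r i)))))"
    by (simp only: of_real_eq_iff)
  show "\<exists>a b :: int.
      real_of_int a =
        of_int d * of_int q' ^ (N - n + 1) / (\<Prod>i\<in>{1..n}. fact (r i)) * dedekind_sum n r q' p \<and>
      real_of_int b =
        (\<Sum>m\<in>even_compositions_with_zero N n.
           - of_int d *
           (\<Prod>i\<in>{1..n}. bernoulli (m i) / fact (m i) * ((real (m i) - 1) gchoose (r i - 1)) *
              of_int (mod_powi q' ((p(n := -1)) i) (int (m i) - int (r i))))) \<and>
      [a = b] (mod q')"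
    using a_eq b_eq cong unfolding M_def a'_def by blast
qed

end
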